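(* Let $K=\mathbf{Q}_3$, $P(T)=T^3+6T^2+9T$ and $u_0=-3$; for $n\ge0$ let $u_{n+1}\in\overline{\mathbf{Q}}_3$ be a root of $P(T)=u_n$, and let $K_\infty=\bigcup_{n\ge1}\mathbf{Q}_3(u_n)$. Then $K_\infty=\mathbf{Q}_3(\mu_{3^\infty})^{\{\pm1\}}$ (the fixed field of the subgroup $\{\pm1\}\subset\mathbf{Z}_3^\times\cong\mathrm{Gal}(\mathbf{Q}_3(\mu_{3^\infty})/\mathbf{Q}_3)$), and $\eta=\chi_{\mathrm{cyc}}^2$.
   Context: Here $\mu_{3^\infty}$ is the group of $3$-power roots of unity and $\chi_{\mathrm{cyc}}$ the cyclotomic character. With $\Gamma=\mathrm{Gal}(K_\infty/\mathbf{Q}_3)$ (the extension is Galois), for each $g\in\Gamma$ there is a unique $\mathrm{Col}_g(T)\in\mathbf{Z}_3[[T]]$ with $g(u_n)=\mathrm{Col}_g(u_n)$ for all $n\ge0$, and $\eta(g):=\mathrm{Col}_g'(0)$ defines a character $\eta:\Gamma\to\mathbf{Z}_3^\times$; the claim $\eta=\chi_{\mathrm{cyc}}^2$ is as characters of $\mathrm{Gal}(\overline{\mathbf{Q}}_3/\mathbf{Q}_3)$. *)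

theory Defs
  imports
    "HOL-Algebra.Algebraic_Closure_Type"
    "HOL-Algebra.Generated_Fields"
    "HOL-Computational_Algebra.Fraction_Field"
    "HOL-Computational_Algebra.Formal_Power_Series"
begin

section \<open>The ring of 3-adic integers\<close>

text \<open>
  The inverse limit of the rings of integers modulo \<open>3 ^ n\<close>. An element is given by its
  residues; the compatibility condition forces the \<open>n\<close>-th residue to be the canonical
  representative in \<open>{0..<3 ^ n}\<close>.
\<close>

typedef z3 = "{f :: nat \<Rightarrow> int. \<forall>n. f n = f (Suc n) mod 3 ^ n}"
  morphisms residue Abs_z3
  by (rule exI[of _ "\<lambda>_. 0"]) auto

setup_lifting type_definition_z3

lemma mod_Suc_power_mod: "(x :: int) mod 3 ^ Suc n mod 3 ^ n = x mod 3 ^ n"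
  by (rule mod_mod_cancel) (simp add: le_imp_power_dvd)

lemma residue_Suc_mod: "residue a (Suc n) mod 3 ^ n = residue a n"
  using residue[of a] by (metis (mono_tags, lifting) mem_Collect_eq)

lemma residue_mod_self: "residue a n mod 3 ^ n = residue a n"
  by (metis residue_Suc_mod mod_mod_trivial)

lemma z3_eqI: "(\<And>n. residue a n = residue b n) \<Longrightarrow> a = b"
  by (simp add: residue_inject[symmetric] fun_eq_iff)

instantiation z3 :: comm_ring_1
begin

lift_definition zero_z3 :: z3 is "\<lambda>_. 0" by simp

lift_definition one_z3 :: z3 is "\<lambda>n. 1 mod 3 ^ n"
  by (simp only: mod_Suc_power_mod simp_thms)

lift_definition plus_z3 :: "z3 \<Rightarrow> z3 \<Rightarrow> z3" is "\<lambda>f g n. (f n + g n) mod 3 ^ n"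
proof -
  fix f g :: "nat \<Rightarrow> int" and n :: nat
  assume f: "\<And>n. f n = f (Suc n) mod 3 ^ n" and g: "\<And>n. g n = g (Suc n) mod 3 ^ n"
  show "(f n + g n) mod 3 ^ n = (f (Suc n) + g (Suc n)) mod 3 ^ Suc n mod 3 ^ n"
    unfolding mod_Suc_power_mod f[of n] g[of n] by (rule mod_add_eq)
qed

lift_definition minus_z3 :: "z3 \<Rightarrow> z3 \<Rightarrow> z3" is "\<lambda>f g n. (f n - g n) mod 3 ^ n"
proof -
  fix f g :: "nat \<Rightarrow> int" and n :: nat
  assume f: "\<And>n. f n = f (Suc n) mod 3 ^ n" and g: "\<And>n. g n = g (Suc n) mod 3 ^ n"
  show "(f n - g n) mod 3 ^ n = (f (Suc n) - g (Suc n)) mod 3 ^ Suc n mod 3 ^ n"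
    unfolding mod_Suc_power_mod f[of n] g[of n] by (rule mod_diff_eq)
qed

lift_definition uminus_z3 :: "z3 \<Rightarrow> z3" is "\<lambda>f n. (- f n) mod 3 ^ n"
proof -
  fix f :: "nat \<Rightarrow> int" and n :: nat
  assume f: "\<And>n. f n = f (Suc n) mod 3 ^ n"
  show "(- f n) mod 3 ^ n = (- f (Suc n)) mod 3 ^ Suc n mod 3 ^ n"
    unfolding mod_Suc_power_mod f[of n] by (rule mod_minus_eq)
qed

lift_definition times_z3 :: "z3 \<Rightarrow> z3 \<Rightarrow> z3" is "\<lambda>f g n. (f n * g n) mod 3 ^ n"
proof -
  fix f g :: "nat \<Rightarrow> int" and n :: nat
  assume f: "\<And>n. f n = f (Suc n) mod 3 ^ n" and g: "\<And>n. g n = g (Suc n) mod 3 ^ n"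
  show "(f n * g n) mod 3 ^ n = (f (Suc n) * g (Suc n)) mod 3 ^ Suc n mod 3 ^ n"
    unfolding mod_Suc_power_mod f[of n] g[of n] by (rule mod_mult_eq)
qed

lemmas residue_simps =
  zero_z3.rep_eq one_z3.rep_eq plus_z3.rep_eq minus_z3.rep_eq uminus_z3.rep_eq times_z3.rep_eq

instance
proof
  fix a b c :: z3
  show "a + b + c = a + (b + c)"
    by (rule z3_eqI) (simp add: residue_simps mod_simps add.assoc)
  show "a + b = b + a"
    by (rule z3_eqI) (simp add: residue_simps add.commute)
  show "0 + a = a"
    by (rule z3_eqI) (simp add: residue_simps residue_mod_self)
  show "- a + a = 0"
    by (rule z3_eqI) (simp add: residue_simps mod_simps)
  show "a - b = a + - b"
    by (rule z3_eqI) (simp add: residue_simps mod_simps)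
  show "a * b * c = a * (b * c)"
    by (rule z3_eqI) (simp add: residue_simps mod_simps mult.assoc)
  show "a * b = b * a"
    by (rule z3_eqI) (simp add: residue_simps mult.commute)
  show "1 * a = a"
    by (rule z3_eqI) (simp add: residue_simps mod_simps residue_mod_self)
  show "(a + b) * c = a * c + b * c"
    by (rule z3_eqI) (simp add: residue_simps mod_simps distrib_right)
  have "residue 0 1 \<noteq> residue 1 1"
    by (simp add: residue_simps)
  thus "(0 :: z3) \<noteq> 1" by metis
qed

end

lemma residue_mod: "residue a (n + k) mod 3 ^ n = residue a n"
proof (induction k)
  case 0
  show ?case by (simp add: residue_mod_self)
next
  case (Suc k)
  have "residue a (n + Suc k) mod 3 ^ n = residue a (Suc (n + k)) mod 3 ^ (n + k) mod 3 ^ n"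
    by (simp add: mod_mod_cancel le_imp_power_dvd)
  also have "residue a (Suc (n + k)) mod 3 ^ (n + k) = residue a (n + k)"
    by (rule residue_Suc_mod)
  finally show ?case using Suc by simp
qed

instance z3 :: idom
proof
  fix a b :: z3
  assume "a \<noteq> 0" "b \<noteq> 0"
  then obtain m k where m: "residue a m \<noteq> 0" and k: "residue b k \<noteq> 0"
    by (auto simp: residue_inject[symmetric] zero_z3.rep_eq fun_eq_iff)
  have 1: "\<not> 3 ^ m dvd residue a (m + k)"
    using m residue_mod[of a m k] by (simp add: dvd_eq_mod_eq_0)
  have 2: "\<not> 3 ^ k dvd residue b (m + k)"
    using k residue_mod[of b k m] by (simp add: dvd_eq_mod_eq_0 add.commute)
  show "a * b \<noteq> 0"
  proof
    assume "a * b = 0"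
    hence "(residue a (m + k) * residue b (m + k)) mod 3 ^ (m + k) = 0"
      by (metis times_z3.rep_eq zero_z3.rep_eq)
    hence d: "3 ^ (m + k) dvd residue a (m + k) * residue b (m + k)"
      by (simp add: dvd_eq_mod_eq_0)
    have p: "prime_elem (3 :: int)"
      by (simp add: prime_imp_prime_elem)
    from 1 have "m > 0" by (cases m) auto
    hence "m + k = Suc (m + k - 1)" by simp
    moreover have "3 ^ (m + k - 1) dvd residue a (m + k) * residue b (m + k)"
      using d by (rule dvd_trans[OF le_imp_power_dvd, rotated]) simp
    ultimately show False
      using prime_elem_power_dvd_cases[OF _ _ p] 1 2 by metis
  qed
qed


section \<open>The field of 3-adic numbers and its algebraic closure\<close>

type_synonym q3 = "z3 fract"
type_synonym q3bar = "q3 alg_closure"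

abbreviation Q3 :: "q3bar set" where
  "Q3 \<equiv> range to_ac"

definition of_z3 :: "z3 \<Rightarrow> q3bar" where
  "of_z3 a = to_ac (Fraction_Field.Fract a 1)"

text \<open>The field obtained from \<^term>\<open>Q3\<close> by adjoining \<open>S\<close>.\<close>

definition Q3_adjoin :: "q3bar set \<Rightarrow> q3bar set" where
  "Q3_adjoin S = generate_field ring_of_type_algebra (Q3 \<union> S)"

text \<open>
  The automorphisms of a subfield \<open>L\<close> that fix \<open>K\<close> pointwise. Elements are functions with
  value \<^term>\<open>undefined\<close> outside \<open>L\<close>, so that they are determined by their action on \<open>L\<close>.
  The absolute Galois group is \<open>Gal UNIV Q3\<close>.
\<close>

definition Gal :: "'a::field set \<Rightarrow> 'a set \<Rightarrow> ('a \<Rightarrow> 'a) set" where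
  "Gal L K = {\<sigma> \<in> extensional L. bij_betw \<sigma> L L \<and>
     (\<forall>x\<in>L. \<forall>y\<in>L. \<sigma> (x + y) = \<sigma> x + \<sigma> y \<and> \<sigma> (x * y) = \<sigma> x * \<sigma> y) \<and>
     (\<forall>x\<in>K. \<sigma> x = x)}"

definition fixed_field :: "'a set \<Rightarrow> ('a \<Rightarrow> 'a) set \<Rightarrow> 'a set" where
  "fixed_field L H = {x \<in> L. \<forall>\<sigma>\<in>H. \<sigma> x = x}"


section \<open>The cyclotomic character\<close>

definition mu_3inf :: "q3bar set" where
  "mu_3inf = {\<zeta>. \<exists>n. \<zeta> ^ (3 ^ n) = 1}"

text \<open>
  The unit \<open>a\<close> with \<open>\<sigma> \<zeta> = \<zeta> ^ a\<close> for all 3-power roots of unity \<open>\<zeta>\<close>, where \<open>\<zeta> ^ a\<close> is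
  \<open>\<zeta> ^ (a mod 3 ^ n)\<close> whenever \<open>\<zeta> ^ (3 ^ n) = 1\<close>. This is used both for elements of the
  absolute Galois group and for automorphisms of \<open>Q3_adjoin mu_3inf\<close>; on the latter it is
  the canonical isomorphism onto the units of \<^typ>\<open>z3\<close>.
\<close>

definition chi_cyc :: "(q3bar \<Rightarrow> q3bar) \<Rightarrow> z3" where
  "chi_cyc \<sigma> = (THE a. a dvd 1 \<and>
     (\<forall>n \<zeta>. \<zeta> ^ (3 ^ n) = 1 \<longrightarrow> \<sigma> \<zeta> = \<zeta> ^ nat (residue a n)))"


section \<open>Power series with 3-adic integer coefficients\<close>

definition integral_z3 :: "q3bar \<Rightarrow> bool" where
  "integral_z3 x \<longleftrightarrow> (\<exists>p :: z3 poly. lead_coeff p = 1 \<and> poly (map_poly of_z3 p) x = 0)"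

text \<open>
  Convergence in the 3-adic topology of \<^typ>\<open>q3bar\<close>: a neighbourhood basis of \<open>0\<close> is formed
  by the sets \<open>3 ^ m * O\<close>, where \<open>O\<close> is the ring of integers, that is, the integral closure
  of the 3-adic integers.
\<close>

definition tendsto_3adic :: "(nat \<Rightarrow> q3bar) \<Rightarrow> q3bar \<Rightarrow> bool" where
  "tendsto_3adic s l \<longleftrightarrow>
     (\<forall>m. \<forall>\<^sub>F n in sequentially. \<exists>y. integral_z3 y \<and> s n - l = 3 ^ m * y)"

definition fps_has_value :: "z3 fps \<Rightarrow> q3bar \<Rightarrow> q3bar \<Rightarrow> bool" where
  "fps_has_value f x y \<longleftrightarrow>
     tendsto_3adic (\<lambda>N. \<Sum>k<N. of_z3 (fps_nth f k) * x ^ k) y"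


section \<open>The tower generated by a sequence and its character\<close>

definition K_inf :: "(nat \<Rightarrow> q3bar) \<Rightarrow> q3bar set" where
  "K_inf u = (\<Union>n\<in>{1..}. Q3_adjoin {u n})"

definition Col :: "(nat \<Rightarrow> q3bar) \<Rightarrow> (q3bar \<Rightarrow> q3bar) \<Rightarrow> z3 fps" where
  "Col u g = (THE f. \<forall>n. fps_has_value f (u n) (g (u n)))"

definition eta :: "(nat \<Rightarrow> q3bar) \<Rightarrow> (q3bar \<Rightarrow> q3bar) \<Rightarrow> z3" where
  "eta u g = fps_nth (fps_deriv (Col u g)) 0"

end

theory Submission
  imports Defs "Jordan_Normal_Form.Char_Poly" "HOL-Number_Theory.Cong"
begin

text \<open>
  Substituting \<open>T = x + 1/x - 2\<close> turns \<open>P\<close> into \<open>x \<mapsto> x\<^sup>3\<close>, so \<open>u\<^sub>n = z\<^sub>n + 1/z\<^sub>n - 2\<close> for compatible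
  primitive roots of unity \<open>z\<^sub>n\<close> of order \<open>3\<^sup>n\<^sup>+\<^sup>1\<close>. With \<open>s = z\<^sub>0 - 1/z\<^sub>0\<close>, the cyclotomic field is
  \<open>K\<^sub>\<infinity> + K\<^sub>\<infinity> s\<close> and \<open>s\<^sup>2 \<in> K\<^sub>\<infinity>\<close>. If \<open>s \<in> K\<^sub>\<infinity>\<close>, both fields agree; otherwise
  \<open>a + b s \<mapsto> a - b s\<close> is an automorphism with cyclotomic character \<open>-1\<close> and fixed field \<open>K\<^sub>\<infinity>\<close>.
  Either way the fixed field is \<open>K\<^sub>\<infinity>\<close>, and no irreducibility of cyclotomic polynomials is needed.

  For \<open>g\<close> with \<open>a = \<chi>(g)\<close> the series \<open>Col\<^sub>g\<close> must send \<open>x + 1/x - 2\<close> to \<open>x\<^sup>a + x\<^sup>-\<^sup>a - 2\<close> at all \<open>x = z\<^sub>n\<close>.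
  For positive integers \<open>a\<close> this is a polynomial whose coefficients depend on \<open>a\<close> through
  integer-valued polynomials, which extend to 3-adic \<open>a\<close> by continuity; the linear coefficient is
  \<open>a\<^sup>2\<close>. Uniqueness holds since the valuations of the \<open>u\<^sub>n\<close> are positive and tend to \<open>0\<close>.
\<close>

section \<open>The 3-adic integers\<close>

lemma residue_of_nat: "residue (of_nat m) n = int m mod 3 ^ n"
  by (induction m) (simp_all add: residue_simps mod_simps)

lemma residue_of_int: "residue (of_int m) n = m mod 3 ^ n"
  by (cases m rule: int_cases2) (simp_all add: residue_of_nat residue_simps mod_simps)

lemma residue_range: "0 \<le> residue a n" "residue a n < 3 ^ n"
  using residue_mod_self[of a n] pos_mod_sign[of "3 ^ n" "residue a n"]
    pos_mod_bound[of "3 ^ n" "residue a n"] by simp_all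

lemma residue_0 [simp]: "residue a 0 = 0"
  using residue_range[of a 0] by simp

lemma residue_mod_le: "n \<le> m \<Longrightarrow> residue a m mod 3 ^ n = residue a n"
  using residue_mod[of a n "m - n"] by simp

instance z3 :: ring_char_0
proof
  show "inj (of_nat :: nat \<Rightarrow> z3)"
  proof (rule injI)
    fix x y :: nat
    assume *: "(of_nat x :: z3) = of_nat y"
    define n where "n = max x y"
    have "int x mod 3 ^ n = int y mod 3 ^ n"
      using * by (metis residue_of_nat)
    moreover have "x < 3 ^ n" "y < 3 ^ n"
      using less_exp[of n] power_mono[of 2 "3::nat" n] unfolding n_def by linarith+
    hence "int x < 3 ^ n" "int y < 3 ^ n"
      by (metis of_nat_less_iff of_nat_numeral of_nat_power)+
    ultimately show "x = y" by simp
  qed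
qed

text \<open>The input need not be reduced: compatibility up to congruence suffices, because reducing
  each term yields the canonical representatives.\<close>

lemma z3_of_residues:
  assumes "\<And>n. f (Suc n) mod 3 ^ n = f n mod (3 ^ n :: int)"
  obtains a where "\<And>n. residue a n = f n mod 3 ^ n"
proof
  fix n
  show "residue (Abs_z3 (\<lambda>n. f n mod 3 ^ n)) n = f n mod 3 ^ n"
    by (subst Abs_z3_inverse) (use assms in \<open>auto simp: mod_Suc_power_mod simp del: power_Suc\<close>)
qed

lemma three_power_dvd_iff: "3 ^ n dvd a \<longleftrightarrow> residue a n = 0"
proof
  assume "3 ^ n dvd a"
  then obtain b where "a = of_int (3 ^ n) * b" by auto
  thus "residue a n = 0" by (simp only: residue_simps residue_of_int) simp
next
  assume a: "residue a n = 0"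
  \<comment> \<open>Dividing by 3^n loses n digits, so level k of the quotient is read off at level
    n + k.\<close>
  define f where "f k = residue a (n + k) div 3 ^ n" for k
  have dvd: "3 ^ n dvd residue a (n + k)" for k
    using residue_mod[of a n k] a by (simp add: dvd_eq_mod_eq_0)
  have "f (Suc k) mod 3 ^ k = f k mod 3 ^ k" for k
  proof -
    have "residue a (n + k) = residue a (n + Suc k) mod (3 ^ n * 3 ^ k)"
      by (simp add: residue_Suc_mod flip: power_add)
    also have "\<dots> = 3 ^ n * (f (Suc k) mod 3 ^ k)"
      using dvd[of "Suc k"] by (subst zmod_zmult2_eq) (auto simp: f_def)
    finally show ?thesis by (simp add: f_def[of k])
  qed
  then obtain b where b: "\<And>k. residue b k = f k mod 3 ^ k" using z3_of_residues by blast
  have "a = of_int (3 ^ n) * b"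
  proof (rule z3_eqI)
    fix k
    have "residue (of_int (3 ^ n) * b) k = (3 ^ n * f k) mod 3 ^ k"
      by (simp only: residue_simps residue_of_int b) (simp add: mod_simps)
    also have "3 ^ n * f k = residue a (k + n)"
      using dvd[of k] by (simp add: f_def add.commute)
    finally show "residue a k = residue (of_int (3 ^ n) * b) k"
      by (simp add: residue_mod)
  qed
  thus "3 ^ n dvd a" by simp
qed

lemma three_power_dvd_diff_residue: "3 ^ n dvd a - of_int (residue a n)"
  by (simp add: three_power_dvd_iff residue_simps residue_of_int residue_mod_self)

text \<open>Inverses modulo 3^n are unique, so the inverses of the residues form a compatible
  sequence.\<close>

lemma z3_unit_iff: "a dvd 1 \<longleftrightarrow> residue a 1 \<noteq> 0"
proof
  assume "a dvd 1"
  then obtain b where b: "1 = a * b" by auto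
  have "residue (a * b) 1 = 1" unfolding b[symmetric] by (simp add: residue_simps)
  thus "residue a 1 \<noteq> 0" by (auto simp: times_z3.rep_eq)
next
  assume a: "residue a 1 \<noteq> 0"
  have cop: "coprime (residue a n) (3 ^ n)" for n
  proof (cases n)
    case (Suc m)
    have "residue a n mod 3 = residue a 1"
      using residue_mod_le[of 1 n a] Suc by simp
    hence "\<not> 3 dvd residue a n" using a by auto
    hence "coprime 3 (residue a n)"
      by (simp add: prime_imp_coprime)
    thus ?thesis by (simp add: coprime_commute)
  qed auto
  hence "\<exists>x. [residue a n * x = 1] (mod 3 ^ n)" for n
    by (rule cong_solve_coprime_int)
  then obtain f where f: "\<And>n. [residue a n * f n = 1] (mod 3 ^ n)" by metis
  have "f (Suc n) mod 3 ^ n = f n mod 3 ^ n" for n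
  proof -
    have "[residue a (Suc n) * f (Suc n) = 1] (mod 3 ^ n)"
      using f[of "Suc n"] by (rule cong_dvd_modulus) simp
    moreover have "[residue a (Suc n) = residue a n] (mod 3 ^ n)"
      by (simp add: cong_def residue_Suc_mod residue_mod_self)
    ultimately have "[residue a n * f (Suc n) = residue a n * f n] (mod 3 ^ n)"
      using f[of n] by (meson cong_scalar_right cong_sym cong_trans)
    thus ?thesis using cop[of n] cong_mult_lcancel unfolding cong_def by metis
  qed
  then obtain b where b: "\<And>k. residue b k = f k mod 3 ^ k" using z3_of_residues by blast
  have "a * b = 1"
    by (rule z3_eqI) (use f in \<open>simp add: residue_simps b mod_simps cong_def\<close>)
  thus "a dvd 1" by (metis dvd_triv_left)
qed

text \<open>The exponent e is the valuation: residues vanish up to level e, and the next one does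
  not.\<close>

lemma z3_nonzero_factor:
  fixes a :: z3
  assumes "a \<noteq> 0"
  obtains e b where "a = 3 ^ e * b" "b dvd 1"
proof -
  have ex: "\<exists>n. residue a n \<noteq> 0"
    using assms by (auto simp: residue_inject[symmetric] zero_z3.rep_eq fun_eq_iff)
  define n where "n = (LEAST n. residue a n \<noteq> 0)"
  have n: "residue a n \<noteq> 0" unfolding n_def by (rule LeastI_ex[OF ex])
  then obtain e where e: "n = Suc e" by (cases n) auto
  have "residue a e = 0" using not_less_Least[of e "\<lambda>n. residue a n \<noteq> 0"] e n_def by auto
  then obtain b where b: "a = 3 ^ e * b"
    unfolding three_power_dvd_iff[symmetric] by auto
  have "residue b 1 \<noteq> 0"
  proof
    assume "residue b 1 = 0"
    hence "3 ^ 1 dvd b" by (simp only: three_power_dvd_iff)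
    hence "3 ^ n dvd a" unfolding b e by (simp add: mult_dvd_mono)
    thus False using n by (simp add: three_power_dvd_iff)
  qed
  thus ?thesis using b that z3_unit_iff by blast
qed

section \<open>Embedding the 3-adic integers into the algebraic closure\<close>

instance fract :: ("{idom, ring_char_0}") field_char_0
proof
  have "of_nat n = Fraction_Field.Fract (of_nat n :: 'a) 1" for n
    by (induction n) (auto simp: Zero_fract_def One_fract_def)
  thus "inj (of_nat :: nat \<Rightarrow> 'a fract)"
    by (auto intro!: injI simp: eq_fract)
qed

lemma of_z3_0 [simp]: "of_z3 0 = 0"
  and of_z3_1 [simp]: "of_z3 1 = 1"
  by (simp_all add: of_z3_def flip: Zero_fract_def One_fract_def)

lemma of_z3_add [simp]: "of_z3 (a + b) = of_z3 a + of_z3 b"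
  and of_z3_mult [simp]: "of_z3 (a * b) = of_z3 a * of_z3 b"
  by (simp_all add: of_z3_def flip: to_ac_add to_ac_mult)

interpretation of_z3: comm_ring_hom of_z3
  by unfold_locales auto

lemma of_z3_uminus [simp]: "of_z3 (- a) = - of_z3 a"
  and of_z3_diff [simp]: "of_z3 (a - b) = of_z3 a - of_z3 b"
  and of_z3_power [simp]: "of_z3 (a ^ n) = of_z3 a ^ n"
  by (simp_all add: of_z3.hom_uminus of_z3.hom_minus of_z3.hom_power)

lemma of_z3_of_nat [simp]: "of_z3 (of_nat m) = of_nat m"
  by (induction m) simp_all

lemma of_z3_numeral [simp]: "of_z3 (numeral k) = numeral k"
  using of_z3_of_nat[of "numeral k"] by (simp del: of_z3_of_nat)

lemma of_z3_eq_iff [simp]: "of_z3 a = of_z3 b \<longleftrightarrow> a = b"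
  by (simp add: of_z3_def eq_fract)

lemma of_z3_eq_0_iff [simp]: "of_z3 a = 0 \<longleftrightarrow> a = 0"
  using of_z3_eq_iff[of a 0] by (simp del: of_z3_eq_iff)

interpretation z3_module: Modules.module "\<lambda>a x. of_z3 a * x"
  by unfold_locales (simp_all add: algebra_simps)

section \<open>The ring of integers of the algebraic closure\<close>

text \<open>
  Multiplication by \<open>x\<close> acts on \<open>S\<close> through a matrix over \<^typ>\<open>z3\<close>; as \<open>S\<close> is an eigenvector with
  eigenvalue \<open>x\<close>, the characteristic polynomial is a monic equation for \<open>x\<close>.
\<close>

lemma integral_z3I:
  assumes "finite S" "v \<in> S" "v \<noteq> 0" "\<And>s. s \<in> S \<Longrightarrow> x * s \<in> z3_module.span S"
  shows "integral_z3 x"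
proof -
  define n where "n = card S"
  obtain e where e: "bij_betw e {0..<n} S"
    using ex_bij_betw_nat_finite[OF assms(1)] unfolding n_def by blast
  have "\<exists>c. x * s = (\<Sum>t\<in>S. of_z3 (c t) * t)" if "s \<in> S" for s
    using assms(4)[OF that] unfolding z3_module.span_finite[OF assms(1)] by auto
  then obtain c where c: "\<And>s. s \<in> S \<Longrightarrow> x * s = (\<Sum>t\<in>S. of_z3 (c s t) * t)" by metis
  define A where "A = mat n n (\<lambda>(i, j). c (e i) (e j))"
  define w where "w = vec n e"
  have A: "A \<in> carrier_mat n n" by (simp add: A_def)
  have A': "map_mat of_z3 A \<in> carrier_mat n n" using A by simp
  have "eigenvector (map_mat of_z3 A) w x"
    unfolding eigenvector_def
  proof (intro conjI)
    show "w \<in> carrier_vec (dim_row (map_mat of_z3 A))" using A by (simp add: w_def)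
    obtain i where i: "i < n" "e i = v"
      using e assms(2) unfolding bij_betw_def by (metis atLeastLessThan_iff imageE)
    hence "vec_index w i \<noteq> 0" using assms(3) by (simp add: w_def)
    thus "w \<noteq> 0\<^sub>v (dim_row (map_mat of_z3 A))" using i(1) A by auto
    show "map_mat of_z3 A *\<^sub>v w = x \<cdot>\<^sub>v w"
    proof (rule eq_vecI)
      fix i assume "i < dim_vec (x \<cdot>\<^sub>v w)"
      hence i: "i < n" by (simp add: w_def)
      have "vec_index (map_mat of_z3 A *\<^sub>v w) i = (\<Sum>j\<in>{0..<n}. of_z3 (c (e i) (e j)) * e j)"
        using i by (simp add: A_def w_def scalar_prod_def)
      also have "\<dots> = (\<Sum>t\<in>S. of_z3 (c (e i) t) * t)"
        by (rule sum.reindex_bij_betw[OF e])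
      also have "\<dots> = x * e i"
        using c i e by (auto simp: bij_betw_def)
      finally show "vec_index (map_mat of_z3 A *\<^sub>v w) i = vec_index (x \<cdot>\<^sub>v w) i"
        using i by (simp add: w_def)
    qed (use A in \<open>simp add: w_def\<close>)
  qed
  hence "poly (char_poly (map_mat of_z3 A)) x = 0"
    using eigenvalue_root_char_poly[OF A'] unfolding eigenvalue_def by blast
  hence "poly (map_poly of_z3 (char_poly A)) x = 0"
    by (simp add: of_z3.char_poly_hom[OF A])
  moreover have "lead_coeff (char_poly A) = 1"
    using degree_monic_char_poly[OF A] by simp
  ultimately show ?thesis unfolding integral_z3_def by blast
qed

lemma integral_z3E:
  assumes "integral_z3 x"
  obtains n c where "n > 0" "x ^ n = (\<Sum>i<n. of_z3 (c i) * x ^ i)"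
proof -
  obtain p where p: "lead_coeff p = 1" "poly (map_poly of_z3 p) x = 0"
    using assms unfolding integral_z3_def by blast
  define n where "n = degree p"
  have sum: "0 = (\<Sum>i<n. of_z3 (coeff p i) * x ^ i) + x ^ n"
  proof -
    have "poly (map_poly of_z3 p) x = (\<Sum>i\<le>n. of_z3 (coeff p i) * x ^ i)"
      unfolding poly_altdef n_def
      by (simp add: coeff_map_poly degree_map_poly)
    thus ?thesis using p by (simp add: n_def lessThan_Suc_atMost[symmetric])
  qed
  \<comment> \<open>For n = 0 the equation would read 0 = 1.\<close>
  have "n > 0" using sum by (cases n) auto
  moreover have "x ^ n = (\<Sum>i<n. of_z3 (- coeff p i) * x ^ i)"
    using sum by (simp add: sum_negf eq_neg_iff_add_eq_0 add.commute)
  ultimately show ?thesis by (rule that)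
qed

text \<open>Stability of the generators extends to the span by linearity; this lets two
  multiplications be applied in turn.\<close>

lemma span_mult_left:
  assumes "\<And>s. s \<in> S \<Longrightarrow> x * s \<in> z3_module.span S" "y \<in> z3_module.span S"
  shows "x * y \<in> z3_module.span S"
  using assms(2)
proof (induction rule: z3_module.span_induct_alt)
  case (step c s y)
  have "x * (of_z3 c * s + y) = of_z3 c * (x * s) + x * y" by (simp add: algebra_simps)
  thus ?case
    using z3_module.span_add[OF z3_module.span_scale[OF assms(1)[OF step(1)]] step(2)] by simp
qed (simp add: z3_module.span_zero)

text \<open>The powers \<open>x\<^sup>i y\<^sup>j\<close> below the degrees span a module stable under both \<open>x\<close> and \<open>y\<close>.\<close>

lemma integral_z3_common_module:
  assumes "integral_z3 x" "integral_z3 y"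
  shows "\<exists>S. finite S \<and> 1 \<in> S \<and>
           (\<forall>s\<in>S. x * s \<in> z3_module.span S \<and> y * s \<in> z3_module.span S)"
proof -
  obtain m c where m: "m > 0" "x ^ m = (\<Sum>i<m. of_z3 (c i) * x ^ i)"
    using integral_z3E[OF assms(1)] .
  obtain n d where n: "n > 0" "y ^ n = (\<Sum>i<n. of_z3 (d i) * y ^ i)"
    using integral_z3E[OF assms(2)] .
  define S where "S = (\<lambda>(i, j). x ^ i * y ^ j) ` ({..<m} \<times> {..<n})"
  have S: "x ^ i * y ^ j \<in> S" if "i < m" "j < n" for i j
    using that unfolding S_def by force
  show ?thesis
  proof (intro exI conjI ballI)
    show "finite S" by (simp add: S_def)
    show "1 \<in> S" using S[of 0 0] m n by simp
    fix s assume "s \<in> S"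
    then obtain i j where ij: "s = x ^ i * y ^ j" "i < m" "j < n" unfolding S_def by auto
    show "x * s \<in> z3_module.span S"
    proof (cases "Suc i < m")
      case True
      thus ?thesis using S[of "Suc i" j] ij z3_module.span_base by (simp add: mult.assoc)
    next
      case False
      hence "m = Suc i" using ij by simp
      hence "x * s = x ^ m * y ^ j" using ij by (simp add: mult_ac)
      also have "\<dots> = (\<Sum>k<m. of_z3 (c k) * (x ^ k * y ^ j))"
        unfolding m(2) by (simp add: sum_distrib_right mult.assoc)
      finally show ?thesis
        by (simp only:) (intro z3_module.span_sum z3_module.span_scale z3_module.span_base S; use ij in simp)
    qed
    show "y * s \<in> z3_module.span S"
    proof (cases "Suc j < n")
      case True
      thus ?thesis using S[of i "Suc j"] ij z3_module.span_base by (simp add: mult_ac)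
    next
      case False
      hence "n = Suc j" using ij by simp
      hence "y * s = x ^ i * y ^ n" using ij by (simp add: mult_ac)
      also have "\<dots> = (\<Sum>k<n. of_z3 (d k) * (x ^ i * y ^ k))"
        unfolding n(2) by (simp add: sum_distrib_left mult_ac)
      finally show ?thesis
        by (simp only:) (intro z3_module.span_sum z3_module.span_scale z3_module.span_base S; use ij in simp)
    qed
  qed
qed

text \<open>A module stable under x and y is stable under their sum; the same module serves for
  products.\<close>

lemma integral_z3_add:
  assumes "integral_z3 x" "integral_z3 y"
  shows "integral_z3 (x + y)"
proof -
  obtain S where S: "finite S" "1 \<in> S" "\<And>s. s \<in> S \<Longrightarrow> x * s \<in> z3_module.span S"
    "\<And>s. s \<in> S \<Longrightarrow> y * s \<in> z3_module.span S"
    using integral_z3_common_module[OF assms] by metis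
  show ?thesis
    by (rule integral_z3I[OF S(1,2)])
      (auto simp: distrib_right intro: z3_module.span_add S)
qed

lemma integral_z3_mult:
  assumes "integral_z3 x" "integral_z3 y"
  shows "integral_z3 (x * y)"
proof -
  obtain S where S: "finite S" "1 \<in> S" "\<And>s. s \<in> S \<Longrightarrow> x * s \<in> z3_module.span S"
    "\<And>s. s \<in> S \<Longrightarrow> y * s \<in> z3_module.span S"
    using integral_z3_common_module[OF assms] by metis
  show ?thesis
    by (rule integral_z3I[OF S(1,2)])
      (auto simp: mult.assoc intro: span_mult_left S)
qed

lemma integral_of_z3 [simp]: "integral_z3 (of_z3 a)"
  unfolding integral_z3_def
  by (rule exI[of _ "[:- a, 1:]"]) (simp add: map_poly_pCons)

lemma integral_z3_of_nat [simp]: "integral_z3 (of_nat m)"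
  and integral_z3_0 [simp]: "integral_z3 0"
  and integral_z3_1 [simp]: "integral_z3 1"
  and integral_z3_numeral [simp]: "integral_z3 (numeral k)"
  using integral_of_z3[of "of_nat m"] integral_of_z3[of 0] integral_of_z3[of 1]
    integral_of_z3[of "numeral k"] by (simp_all del: integral_of_z3)

lemma integral_z3_uminus: "integral_z3 x \<Longrightarrow> integral_z3 (- x)"
  using integral_z3_mult[of "of_z3 (- 1)" x] integral_of_z3[of "-1"] by simp

lemma integral_z3_diff: "integral_z3 x \<Longrightarrow> integral_z3 y \<Longrightarrow> integral_z3 (x - y)"
  using integral_z3_add[of x "- y"] integral_z3_uminus by simp

lemma integral_z3_power: "integral_z3 x \<Longrightarrow> integral_z3 (x ^ n)"
  by (induction n) (auto intro: integral_z3_mult)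

lemma integral_z3_sum: "(\<And>i. i \<in> A \<Longrightarrow> integral_z3 (f i)) \<Longrightarrow> integral_z3 (\<Sum>i\<in>A. f i)"
  by (induction A rule: infinite_finite_induct) (auto intro: integral_z3_add)

lemmas integral_z3_intros = integral_z3_add integral_z3_mult integral_z3_uminus
  integral_z3_diff integral_z3_power integral_z3_sum integral_of_z3 integral_z3_of_nat
  integral_z3_0 integral_z3_1 integral_z3_numeral

text \<open>If 3 y = 1, a monic equation for y multiplied by 3^n writes 1 as a multiple of 3 in
  \<open>z3\<close>.\<close>

lemma three_not_unit:
  assumes "integral_z3 y"
  shows "3 * y \<noteq> 1"
proof
  assume y: "3 * y = 1"
  obtain n c where n: "n > 0" "y ^ n = (\<Sum>i<n. of_z3 (c i) * y ^ i)"
    using integral_z3E[OF assms] .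
  have "of_z3 1 = (3 * y) ^ n" by (simp add: y)
  also have "\<dots> = (\<Sum>i<n. of_z3 (c i) * 3 ^ (n - i) * (3 * y) ^ i)"
    unfolding power_mult_distrib n(2) sum_distrib_left
    by (rule sum.cong) (auto simp: algebra_simps simp flip: power_add)
  also have "\<dots> = of_z3 (\<Sum>i<n. c i * 3 ^ (n - i))"
    by (simp add: y of_z3.hom_sum)
  finally have "1 = (\<Sum>i<n. c i * 3 ^ (n - i))" by (simp only: of_z3_eq_iff)
  also have "3 ^ 1 dvd \<dots>" by (intro dvd_sum dvd_mult le_imp_power_dvd) auto
  finally show False unfolding three_power_dvd_iff by (simp add: residue_simps)
qed

text \<open>Put t = 1 + 3 w. An equation for w gives a monic equation for 1 - t = -3 w whose lower
  coefficients are divisible by 3. Modulo t it reads 1 = b with 3 dividing b, so t divides the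
  3-adic unit 1 - b.\<close>

lemma integral_z3_inverse_one_plus_three:
  assumes "integral_z3 w"
  obtains y where "integral_z3 y" "(1 + 3 * w) * y = 1"
proof -
  obtain n c where n: "n > 0" "w ^ n = (\<Sum>i<n. of_z3 (c i) * w ^ i)"
    using integral_z3E[OF assms] .
  define t where "t = 1 + 3 * w"
  have t: "integral_z3 t" unfolding t_def by (intro integral_z3_intros assms)
  have "\<exists>r. integral_z3 r \<and> (1 - t) ^ i = 1 - t * r" for i
  proof (induction i)
    case (Suc i)
    then obtain r where r: "integral_z3 r" "(1 - t) ^ i = 1 - t * r" by blast
    show ?case
      by (rule exI[of _ "r + (1 - t) ^ i"], intro conjI integral_z3_intros r(1) t)
        (simp add: r(2) algebra_simps)
  qed (auto intro: exI[of _ 0])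
  then obtain r where r: "\<And>i. integral_z3 (r i)" "\<And>i. (1 - t) ^ i = 1 - t * r i" by metis
  define b where "b = (\<Sum>i<n. c i * (- 3) ^ (n - i))"
  define R where "R = (\<Sum>i<n. of_z3 (c i) * (- 3) ^ (n - i) * r i)"
  have R: "integral_z3 R"
    unfolding R_def by (intro integral_z3_intros r)
  have "1 - t * r n = (1 - t) ^ n" by (simp add: r(2))
  also have "1 - t = - 3 * w" by (simp add: t_def)
  also have "(- 3 * w) ^ n = (\<Sum>i<n. of_z3 (c i) * (- 3) ^ (n - i) * (- 3 * w) ^ i)"
    unfolding power_mult_distrib n(2) sum_distrib_left
    by (rule sum.cong) (auto simp: algebra_simps simp flip: power_add)
  also have "- 3 * w = 1 - t" by (simp add: t_def)
  also have "(\<Sum>i<n. of_z3 (c i) * (- 3) ^ (n - i) * (1 - t) ^ i) = of_z3 b - t * R"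
    unfolding b_def R_def r(2)
    by (simp add: of_z3.hom_sum sum_distrib_left sum_subtractf algebra_simps)
  finally have eq: "t * (r n - R) = of_z3 (1 - b)" by (simp add: algebra_simps)
  have "3 ^ 1 dvd b" unfolding b_def
    by (intro dvd_sum dvd_mult dvd_power_le) auto
  hence "residue b 1 = 0" by (simp only: three_power_dvd_iff)
  hence "(1 - b) dvd 1" by (simp add: z3_unit_iff minus_z3.rep_eq one_z3.rep_eq)
  then obtain b' where b': "1 = (1 - b) * b'" by auto
  show ?thesis
  proof (rule that)
    show "integral_z3 ((r n - R) * of_z3 b')" by (intro integral_z3_intros r R)
    show "(1 + 3 * w) * ((r n - R) * of_z3 b') = 1"
      unfolding t_def[symmetric] mult.assoc[symmetric] eq of_z3_mult[symmetric] b'[symmetric]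
      by simp
  qed
qed

text \<open>If \<open>v\<close> is topologically nilpotent, then \<open>1 + v\<close> divides \<open>1 - (- v)\<^sup>m\<close>, a unit.\<close>

lemma integral_z3_inverse_one_plus:
  assumes v: "integral_z3 v" and w: "integral_z3 w" "v ^ m = 3 * w"
  obtains y where "integral_z3 y" "(1 + v) * y = 1"
proof -
  have "integral_z3 (- ((- 1) ^ m * w))" by (intro integral_z3_intros w)
  then obtain y where y: "integral_z3 y" "(1 + 3 * (- ((- 1) ^ m * w))) * y = 1"
    by (rule integral_z3_inverse_one_plus_three)
  have "1 + 3 * (- ((- 1) ^ m * w)) = 1 - (- 1) ^ m * v ^ m"
    unfolding w(2) by simp
  also have "\<dots> = 1 - (- v) ^ m"
    by (metis power_mult_distrib mult_minus1)
  also have "\<dots> = (1 + v) * (\<Sum>i<m. (- v) ^ i)"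
    using one_diff_power_eq[of "- v" m] by simp
  finally have "(1 + v) * ((\<Sum>i<m. (- v) ^ i) * y) = 1" using y by (simp add: mult.assoc)
  moreover have "integral_z3 ((\<Sum>i<m. (- v) ^ i) * y)" by (intro integral_z3_intros y v)
  ultimately show ?thesis using that by blast
qed

section \<open>The cyclotomic tower and the cyclotomic character\<close>

lemma mu_3inf_mult: "x \<in> mu_3inf \<Longrightarrow> y \<in> mu_3inf \<Longrightarrow> x * y \<in> mu_3inf"
proof -
  assume "x \<in> mu_3inf" "y \<in> mu_3inf"
  then obtain m n where mn: "x ^ (3 ^ m) = 1" "y ^ (3 ^ n) = 1"
    unfolding mu_3inf_def by blast
  have "(x * y) ^ (3 ^ (m + n)) = (x ^ (3 ^ m)) ^ (3 ^ n) * (y ^ (3 ^ n)) ^ (3 ^ m)"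
    by (simp add: power_mult_distrib power_add mult.commute flip: power_mult)
  thus ?thesis unfolding mu_3inf_def using mn by auto
qed

lemma one_in_mu_3inf: "1 \<in> mu_3inf"
  by (simp add: mu_3inf_def)

lemma mu_3inf_power: "x \<in> mu_3inf \<Longrightarrow> x ^ k \<in> mu_3inf"
  by (induction k) (auto intro: mu_3inf_mult one_in_mu_3inf)

text \<open>The predicate inside \<open>chi_cyc\<close>, separated out so that existence and
  uniqueness can be proved before the description is evaluated.\<close>

definition cyclotomic_exponent :: "(q3bar \<Rightarrow> q3bar) \<Rightarrow> z3 \<Rightarrow> bool" where
  "cyclotomic_exponent \<sigma> a \<longleftrightarrow> a dvd 1 \<and>
     (\<forall>n \<zeta>. \<zeta> ^ (3 ^ n) = 1 \<longrightarrow> \<sigma> \<zeta> = \<zeta> ^ nat (residue a n))"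

section \<open>The substitution T = x + 1/x - 2\<close>

lemma joukowsky_cube:
  fixes x :: "'a :: field"
  assumes "x \<noteq> 0" "t = x + inverse x - 2"
  shows "t ^ 3 + 6 * t ^ 2 + 9 * t = x ^ 3 + inverse (x ^ 3) - 2"
proof -
  define y where "y = inverse x"
  have "x * y = 1" using assms(1) by (simp add: y_def)
  \<comment> \<open>With y treated as independent of x, the two sides differ by a multiple of x y -
    1; this is a polynomial identity free of inverses.\<close>
  moreover have "t ^ 3 + 6 * t ^ 2 + 9 * t = x ^ 3 + y ^ 3 - 2 + 3 * (x * y - 1) * (x + y)"
    unfolding assms(2) y_def[symmetric]
    by (simp add: algebra_simps power2_eq_square power3_eq_cube)
  ultimately show ?thesis by (simp add: y_def power_inverse)
qed

text \<open>Clearing denominators, the equation factors as (x - y)(x y - 1) = 0.\<close>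

lemma joukowsky_eq:
  fixes x y :: "'a :: field"
  assumes "x \<noteq> 0" "y \<noteq> 0" "x + inverse x = y + inverse y"
  shows "x = y \<or> x = inverse y"
proof -
  have "(x - y) * (x * y - 1) = x * y * (x + inverse x - (y + inverse y))"
    using assms(1,2) by (simp add: field_simps)
  hence "x = y \<or> x * y = 1" using assms(3) by simp
  thus ?thesis using assms(2) by (metis inverse_unique mult.commute)
qed

lemma joukowsky_surj:
  fixes t :: "'a :: alg_closed_field"
  obtains x where "x \<noteq> 0" "t = x + inverse x - 2"
proof -
  have "degree [:1, - (t + 2), 1:] > 0" by simp
  then obtain x where "poly [:1, - (t + 2), 1:] x = 0"
    using alg_closed_imp_poly_has_root by blast
  hence x: "x * x + 1 = (t + 2) * x" by (simp add: algebra_simps)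
  hence "x \<noteq> 0" by auto
  moreover from this x have "t = x + inverse x - 2" by (simp add: field_simps)
  ultimately show ?thesis by (rule that)
qed

locale cyclotomic_tower =
  fixes u z :: "nat \<Rightarrow> q3bar"
  assumes z_0: "z 0 ^ 2 + z 0 + 1 = 0"
    and z_Suc: "z (Suc n) ^ 3 = z n"
    and u_eq: "u n = z n + inverse (z n) - 2"

lemma exists_cyclotomic_tower:
  fixes u :: "nat \<Rightarrow> q3bar"
  assumes "u 0 = -3"
    and "\<And>n. u (Suc n) ^ 3 + 6 * u (Suc n) ^ 2 + 9 * u (Suc n) = u n"
  obtains z where "cyclotomic_tower u z"
proof -
  define P where "P n x \<longleftrightarrow> x \<noteq> 0 \<and> u n = x + inverse x - 2" for n x
  have "\<exists>z. \<forall>n. P n (z n) \<and> z (Suc n) ^ 3 = z n"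
  proof (rule dependent_nat_choice)
    show "\<exists>x. P 0 x" unfolding P_def using joukowsky_surj[of "u 0"] by metis
  next
    fix x n assume "P n x"
    hence x: "x \<noteq> 0" "u n = x + inverse x - 2" by (auto simp: P_def)
    obtain y where y: "y \<noteq> 0" "u (Suc n) = y + inverse y - 2"
      using joukowsky_surj by metis
    have "u n = y ^ 3 + inverse (y ^ 3) - 2"
      using joukowsky_cube[OF y] assms(2) by simp
    hence "y ^ 3 + inverse (y ^ 3) = x + inverse x" using x(2) by simp
    hence "y ^ 3 = x \<or> y ^ 3 = inverse x" using joukowsky_eq[of "y ^ 3" x] x y by simp
    \<comment> \<open>Inverting y leaves \<open>u (Suc n)\<close> unchanged but inverts the cube, so
      one of the two choices fits.\<close>
    hence "P (Suc n) y \<and> y ^ 3 = x \<or> P (Suc n) (inverse y) \<and> inverse y ^ 3 = x"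
      using y by (auto simp: P_def power_inverse add.commute)
    thus "\<exists>y. P (Suc n) y \<and> y ^ 3 = x" by blast
  qed
  then obtain z where z: "\<And>n. P n (z n)" "\<And>n. z (Suc n) ^ 3 = z n" by blast
  have "-3 = z 0 + inverse (z 0) - 2" "z 0 \<noteq> 0" using z(1)[of 0] assms(1) by (auto simp: P_def)
  hence "-1 * z 0 = (z 0 + inverse (z 0)) * z 0" by (simp add: algebra_simps)
  hence "z 0 ^ 2 + z 0 + 1 = 0"
    using \<open>z 0 \<noteq> 0\<close> by (simp add: distrib_right power2_eq_square) (metis add.assoc add.commute add.right_inverse)
  hence "cyclotomic_tower u z"
    using z by unfold_locales (auto simp: P_def)
  thus ?thesis by (rule that)
qed

context cyclotomic_tower
begin

section \<open>Roots of unity of 3-power order\<close>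

lemma z_0_cube: "z 0 ^ 3 = 1"
proof -
  have "z 0 ^ 3 - 1 = (z 0 - 1) * (z 0 ^ 2 + z 0 + 1)"
    by (simp add: algebra_simps power2_eq_square power3_eq_cube)
  thus ?thesis by (simp add: z_0)
qed

lemma z_0_neq_1: "z 0 \<noteq> 1"
  using z_0 by auto

lemma z_0_square_neq_1: "z 0 ^ 2 \<noteq> 1"
proof
  assume "z 0 ^ 2 = 1"
  hence "z 0 ^ 3 = z 0" by (simp add: power3_eq_cube power2_eq_square)
  thus False using z_0_cube z_0_neq_1 by simp
qed

lemma z_nonzero [simp]: "z n \<noteq> 0"
  by (induction n) (use z_0 z_Suc in \<open>auto simp: power_0_left\<close>, metis power_zero_numeral z_Suc)

lemma z_power_to_0: "z n ^ (3 ^ n) = z 0"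
  by (induction n) (simp_all add: power_mult z_Suc)

lemma z_power_Suc [simp]: "z n ^ (3 ^ Suc n) = 1"
  by (metis power_Suc2 power_mult z_power_to_0 z_0_cube)

text \<open>Cubing reduces to level n and yields k = 3^(n+1) j; raising \<open>z (Suc n)\<close> to
  3^(n+1) gives \<open>z 0\<close>, whose order 3 then forces 3 to divide j.\<close>

lemma z_power_eq_1_iff: "z n ^ k = 1 \<longleftrightarrow> 3 ^ Suc n dvd k"
proof
  assume "z n ^ k = 1"
  thus "3 ^ Suc n dvd k"
  proof (induction n arbitrary: k)
    case 0
    have "z 0 ^ k = (z 0 ^ 3) ^ (k div 3) * z 0 ^ (k mod 3)"
      by (simp flip: power_mult power_add)
    hence *: "z 0 ^ (k mod 3) = 1" using 0 by (simp add: z_0_cube)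
    have "k mod 3 = 0 \<or> k mod 3 = 1 \<or> k mod 3 = 2" by linarith
    thus ?case using * z_0_neq_1 z_0_square_neq_1 by (auto simp: dvd_eq_mod_eq_0)
  next
    case (Suc n)
    have "z n ^ k = (z (Suc n) ^ k) ^ 3" by (metis z_Suc power_mult mult.commute)
    hence "3 ^ Suc n dvd k" using Suc by simp
    then obtain j where j: "k = 3 ^ Suc n * j" by auto
    have "z 0 ^ j = 1" using Suc.prems unfolding j by (metis power_mult z_power_to_0)
    moreover have "z 0 ^ j = (z 0 ^ 3) ^ (j div 3) * z 0 ^ (j mod 3)"
      by (simp flip: power_mult power_add)
    ultimately have *: "z 0 ^ (j mod 3) = 1" by (simp add: z_0_cube)
    have "j mod 3 = 0 \<or> j mod 3 = 1 \<or> j mod 3 = 2" by linarith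
    hence "3 dvd j" using * z_0_neq_1 z_0_square_neq_1 by (auto simp: dvd_eq_mod_eq_0)
    thus ?case unfolding j by auto
  qed
qed (auto simp: power_mult simp del: power_Suc)

lemma z_power_eq_iff: "z n ^ i = z n ^ j \<longleftrightarrow> i mod 3 ^ Suc n = j mod 3 ^ Suc n"
proof (induction i j rule: linorder_wlog)
  case (le i j)
  have "z n ^ j = z n ^ i * z n ^ (j - i)" using le by (simp flip: power_add)
  hence "z n ^ i = z n ^ j \<longleftrightarrow> z n ^ (j - i) = 1" by auto
  also have "\<dots> \<longleftrightarrow> j mod 3 ^ Suc n = i mod 3 ^ Suc n"
    unfolding z_power_eq_1_iff by (rule mod_eq_dvd_iff_nat[OF le, symmetric])
  finally show ?case by auto
qed auto

lemma z_in_mu: "z n \<in> mu_3inf"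
  unfolding mu_3inf_def using z_power_Suc by blast

text \<open>The powers of \<open>z n\<close> already supply as many roots of X^N - 1, N = 3^(n+1),
  as its degree allows.\<close>

lemma root_of_unity_eq_z_power:
  assumes "\<zeta> ^ (3 ^ Suc n) = 1"
  shows "\<exists>k<3 ^ Suc n. \<zeta> = z n ^ k"
proof -
  define N :: nat where "N = 3 ^ Suc n"
  define p :: "q3bar poly" where "p = monom 1 N - 1"
  have N: "N > 0" by (simp add: N_def)
  have "coeff p N = 1" using N by (simp add: p_def)
  hence p: "p \<noteq> 0" by auto
  have "degree p \<le> N" unfolding p_def by (intro degree_diff_le degree_monom_le) simp
  have p_iff: "poly p x = 0 \<longleftrightarrow> x ^ N = 1" for x by (simp add: p_def poly_monom)
  have "inj_on (\<lambda>k. z n ^ k) {..<N}"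
    by (rule inj_onI) (simp add: z_power_eq_iff N_def del: power_Suc)
  hence "card ((\<lambda>k. z n ^ k) ` {..<N}) = N" by (simp add: card_image)
  moreover have sub: "(\<lambda>k. z n ^ k) ` {..<N} \<subseteq> {x. poly p x = 0}"
    unfolding p_iff by (auto simp: N_def simp flip: power_mult simp del: power_Suc)
      (metis mult.commute power_mult power_one z_power_Suc)
  moreover have "card {x. poly p x = 0} \<le> N"
    using card_poly_roots_bound[OF p] \<open>degree p \<le> N\<close> by linarith
  ultimately have "(\<lambda>k. z n ^ k) ` {..<N} = {x. poly p x = 0}"
    by (intro card_seteq poly_roots_finite[OF p]) auto
  moreover have "poly p \<zeta> = 0" using assms unfolding p_iff N_def .
  ultimately show ?thesis unfolding N_def[symmetric] by blast
qed

text \<open>The action on \<open>z m\<close> determines the exponent modulo 3^(m+1), which is the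
  residue at level m + 1.\<close>

lemma cyclotomic_exponent_unique:
  assumes "cyclotomic_exponent \<sigma> a" "cyclotomic_exponent \<sigma> b"
  shows "a = b"
proof (rule z3_eqI)
  fix n
  show "residue a n = residue b n"
  proof (cases n)
    case (Suc m)
    have *: "nat (residue c n) mod 3 ^ Suc m = nat (residue c n)" for c
      using residue_range[of c n] Suc
      by (intro mod_less) (simp add: nat_less_iff del: power_Suc)
    have "z m ^ nat (residue a n) = z m ^ nat (residue b n)"
      using assms unfolding cyclotomic_exponent_def Suc by (metis z_power_Suc)
    hence "nat (residue a n) = nat (residue b n)"
      unfolding z_power_eq_iff * .
    thus ?thesis using residue_range(1)[of _ n] by (metis int_nat_eq)
  qed simp
qed

lemma chi_cyc_eqI: "cyclotomic_exponent \<sigma> a \<Longrightarrow> chi_cyc \<sigma> = a"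
  unfolding chi_cyc_def cyclotomic_exponent_def[symmetric]
  using cyclotomic_exponent_unique by blast

text \<open>Write the image of \<open>z n\<close> as its power with exponent \<open>k n\<close>.
  Since \<open>z (Suc n)\<close> cubes to \<open>z n\<close>, the exponents are compatible and
  define a 3-adic integer; injectivity keeps \<open>z 0\<close> from being sent to 1, so it is a
  unit.\<close>

lemma cyclotomic_exponent_chi_cyc:
  assumes mult: "\<And>x y. x \<in> mu_3inf \<Longrightarrow> y \<in> mu_3inf \<Longrightarrow> \<sigma> (x * y) = \<sigma> x * \<sigma> y"
    and one: "\<sigma> 1 = 1" and inj: "inj_on \<sigma> mu_3inf"
  shows "cyclotomic_exponent \<sigma> (chi_cyc \<sigma>)"
proof -
  have pow: "\<sigma> (x ^ k) = \<sigma> x ^ k" if "x \<in> mu_3inf" for x k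
    by (induction k) (use that mult mu_3inf_power one in auto)
  have "\<exists>k<3 ^ Suc n. \<sigma> (z n) = z n ^ k" for n
    using root_of_unity_eq_z_power[of "\<sigma> (z n)" n] pow[OF z_in_mu, of n "3 ^ Suc n"] one
    by (simp only: z_power_Suc)
  then obtain k where k: "\<And>n. k n < 3 ^ Suc n" "\<And>n. \<sigma> (z n) = z n ^ k n" by metis
  have compat: "k (Suc n) mod 3 ^ Suc n = k n mod 3 ^ Suc n" for n
  proof -
    have "z n ^ k (Suc n) = (z (Suc n) ^ k (Suc n)) ^ 3"
      by (metis z_Suc power_mult mult.commute)
    also have "\<dots> = \<sigma> (z (Suc n) ^ 3)" using k pow[OF z_in_mu] by simp
    also have "\<dots> = z n ^ k n" by (simp add: z_Suc k)
    finally show ?thesis by (simp only: z_power_eq_iff)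
  qed
  \<comment> \<open>The order of \<open>z m\<close> is 3^(m+1), so \<open>k m\<close> belongs at
    level m + 1; level 0 gets the only residue modulo 1.\<close>
  define f where "f n = (case n of 0 \<Rightarrow> 0 | Suc m \<Rightarrow> int (k m))" for n
  have "f (Suc n) mod 3 ^ n = f n mod 3 ^ n" for n
  proof (cases n)
    case (Suc m)
    have "int (k (Suc m)) mod int (3 ^ Suc m) = int (k m) mod int (3 ^ Suc m)"
      unfolding of_nat_mod[symmetric] compat ..
    thus ?thesis by (simp add: Suc f_def)
  qed simp
  then obtain a where a: "\<And>n. residue a n = f n mod 3 ^ n" using z3_of_residues by blast
  have a_Suc: "nat (residue a (Suc n)) = k n" for n
  proof -
    have "int (k n) < int (3 ^ Suc n)" using k(1)[of n] by (simp only: of_nat_less_iff)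
    thus ?thesis by (simp add: a f_def)
  qed
  have "\<sigma> (z 0) \<noteq> 1"
    using inj_onD[OF inj, of "z 0" 1] one z_in_mu one_in_mu_3inf z_0_neq_1 by auto
  hence "residue a 1 \<noteq> 0" using a_Suc[of 0] k(2)[of 0] by (intro notI) simp
  hence "a dvd 1" by (simp add: z3_unit_iff)
  moreover have "\<sigma> \<zeta> = \<zeta> ^ nat (residue a n)" if \<zeta>: "\<zeta> ^ (3 ^ n) = 1" for n \<zeta>
  proof (cases n)
    case 0
    thus ?thesis using \<zeta> one by simp
  next
    case (Suc m)
    then obtain j where j: "\<zeta> = z m ^ j" using root_of_unity_eq_z_power[of \<zeta> m] \<zeta> by blast
    have "\<sigma> \<zeta> = (z m ^ k m) ^ j" unfolding j pow[OF z_in_mu] k(2) ..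
    also have "\<dots> = \<zeta> ^ k m" unfolding j by (metis power_mult mult.commute)
    finally show ?thesis by (simp only: Suc a_Suc)
  qed
  ultimately have "cyclotomic_exponent \<sigma> a" unfolding cyclotomic_exponent_def by blast
  thus ?thesis using chi_cyc_eqI by metis
qed

text \<open>The field L is left open to cover both the absolute Galois group and the cyclotomic
  field.\<close>

lemma cyclotomic_exponent_Gal:
  assumes "\<sigma> \<in> Gal L Q3" "mu_3inf \<subseteq> L"
  shows "cyclotomic_exponent \<sigma> (chi_cyc \<sigma>)"
proof (rule cyclotomic_exponent_chi_cyc)
  show "\<sigma> (x * y) = \<sigma> x * \<sigma> y" if "x \<in> mu_3inf" "y \<in> mu_3inf" for x y
    using assms that unfolding Gal_def by auto
  have "1 \<in> Q3" using range_eqI[of 1 to_ac 1] by simp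
  thus "\<sigma> 1 = 1" using assms(1) unfolding Gal_def by blast
  show "inj_on \<sigma> mu_3inf"
    using assms inj_on_subset unfolding Gal_def bij_betw_def by blast
qed

end

section \<open>Intermediate fields and quadratic conjugation\<close>

locale intermediate_field =
  fixes F :: "q3bar set"
  assumes Q3_subset: "Q3 \<subseteq> F"
    and add_closed: "x \<in> F \<Longrightarrow> y \<in> F \<Longrightarrow> x + y \<in> F"
    and mult_closed: "x \<in> F \<Longrightarrow> y \<in> F \<Longrightarrow> x * y \<in> F"
    and uminus_closed: "x \<in> F \<Longrightarrow> - x \<in> F"
    and inverse_closed: "x \<in> F \<Longrightarrow> inverse x \<in> F"
begin

lemma to_ac_closed: "to_ac x \<in> F"
  using Q3_subset by auto

lemma zero_closed: "0 \<in> F" and one_closed: "1 \<in> F" and numeral_closed: "numeral k \<in> F"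
  using to_ac_closed[of 0] to_ac_closed[of 1] to_ac_closed[of "numeral k"] by simp_all

lemma diff_closed: "x \<in> F \<Longrightarrow> y \<in> F \<Longrightarrow> x - y \<in> F"
  using add_closed[of x "- y"] uminus_closed by simp

lemma divide_closed: "x \<in> F \<Longrightarrow> y \<in> F \<Longrightarrow> x / y \<in> F"
  by (simp add: divide_inverse mult_closed inverse_closed)

lemma power_closed: "x \<in> F \<Longrightarrow> x ^ n \<in> F"
  by (induction n) (auto intro: one_closed mult_closed)

lemmas closed = zero_closed one_closed numeral_closed to_ac_closed add_closed mult_closed
  uminus_closed inverse_closed diff_closed divide_closed power_closed

end

lemma inv_ring_of_type_algebra:
  "(x :: 'a :: field) \<noteq> 0 \<Longrightarrow> m_inv ring_of_type_algebra x = inverse x"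
  unfolding m_inv_def ring_of_type_algebra_def
  by (rule the_equality) (auto simp: field_simps)

lemma Q3_adjoin_intermediate: "intermediate_field (Q3_adjoin S)"
proof
  let ?R = "ring_of_type_algebra :: q3bar ring"
  have in_gen: "x \<in> generate_field ?R (Q3 \<union> S)" if "x \<in> Q3" for x
    using that by (intro generate_field.incl) auto
  show "Q3 \<subseteq> Q3_adjoin S" unfolding Q3_adjoin_def using in_gen by blast
  fix x y assume x: "x \<in> Q3_adjoin S"
  show "x + y \<in> Q3_adjoin S" "x * y \<in> Q3_adjoin S" if "y \<in> Q3_adjoin S"
    using x that generate_field.eng_add[of x ?R "Q3 \<union> S" y]
      generate_field.eng_mult[of x ?R "Q3 \<union> S" y]
    unfolding Q3_adjoin_def by (simp_all add: ring_of_type_algebra_def)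
  show "inverse x \<in> Q3_adjoin S"
  proof (cases "x = 0")
    case True
    thus ?thesis using x by simp
  next
    case False
    hence "m_inv ?R x \<in> Q3_adjoin S"
      using x generate_field.m_inv[of x ?R "Q3 \<union> S"]
      unfolding Q3_adjoin_def by (simp add: ring_of_type_algebra_def)
    thus ?thesis using False by (simp add: inv_ring_of_type_algebra)
  qed
  have "ring ?R" by (rule ring_from_type_algebra)
  then interpret R: ring ?R .
  have "a_inv ?R x = - x"
    by (rule R.minus_equality) (simp_all add: ring_of_type_algebra_def)
  moreover have "a_inv ?R x \<in> Q3_adjoin S"
    using x unfolding Q3_adjoin_def by (rule generate_field.a_inv)
  ultimately show "- x \<in> Q3_adjoin S" by simp
qed

lemma subset_Q3_adjoin: "S \<subseteq> Q3_adjoin S"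
  unfolding Q3_adjoin_def by (auto intro: generate_field.incl)

text \<open>With \<open>subset_Q3_adjoin\<close> and \<open>Q3_adjoin_intermediate\<close>, this
  minimality is the interface to adjunction from here on.\<close>

lemma Q3_adjoin_least:
  assumes "intermediate_field F" "S \<subseteq> F"
  shows "Q3_adjoin S \<subseteq> F"
proof
  interpret intermediate_field F by fact
  let ?R = "ring_of_type_algebra :: q3bar ring"
  have "ring ?R" by (rule ring_from_type_algebra)
  then interpret R: ring ?R .
  have a_inv: "a_inv ?R x = - x" for x
    by (rule R.minus_equality) (simp_all add: ring_of_type_algebra_def)
  fix x assume "x \<in> Q3_adjoin S"
  thus "x \<in> F" unfolding Q3_adjoin_def
  proof (induction rule: generate_field.induct)
    case (m_inv h)
    hence "h \<noteq> 0" by (simp add: ring_of_type_algebra_def)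
    thus ?case using m_inv by (simp add: inv_ring_of_type_algebra closed)
  qed (use assms(2) Q3_subset closed in \<open>auto simp: a_inv\<close>,
      auto simp: ring_of_type_algebra_def closed)
qed

section \<open>Automorphisms and their fixed points\<close>

lemma GalD:
  assumes "\<sigma> \<in> Gal L K"
  shows "\<sigma> \<in> extensional L" "bij_betw \<sigma> L L"
    "x \<in> L \<Longrightarrow> y \<in> L \<Longrightarrow> \<sigma> (x + y) = \<sigma> x + \<sigma> y"
    "x \<in> L \<Longrightarrow> y \<in> L \<Longrightarrow> \<sigma> (x * y) = \<sigma> x * \<sigma> y"
    "x \<in> K \<Longrightarrow> \<sigma> x = x"
  using assms unfolding Gal_def by blast+

lemma Gal_uminus:
  assumes "\<sigma> \<in> Gal L Q3" "intermediate_field L" "x \<in> L"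
  shows "\<sigma> (- x) = - \<sigma> x"
proof -
  interpret intermediate_field L by fact
  have "-1 \<in> Q3" using range_eqI[of "-1" to_ac "-1"] by simp
  hence "\<sigma> (- 1 * x) = - 1 * \<sigma> x"
    using GalD(4)[OF assms(1), of "-1" x] GalD(5)[OF assms(1), of "-1"] assms(3) Q3_subset
    by (metis subsetD)
  thus ?thesis by simp
qed

lemma Gal_inverse:
  assumes "\<sigma> \<in> Gal L Q3" "intermediate_field L" "x \<in> L"
  shows "\<sigma> (inverse x) = inverse (\<sigma> x)"
proof (cases "x = 0")
  case True
  have "0 \<in> Q3" using range_eqI[of 0 to_ac 0] by simp
  thus ?thesis using GalD(5)[OF assms(1)] True by simp
next
  case False
  interpret intermediate_field L by fact
  have "1 \<in> Q3" using range_eqI[of 1 to_ac 1] by simp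
  hence "\<sigma> x * \<sigma> (inverse x) = 1"
    using GalD(4)[OF assms(1,3) inverse_closed[OF assms(3)]] GalD(5)[OF assms(1)] False by simp
  thus ?thesis by (metis inverse_unique)
qed

text \<open>This allows checking on generators that an automorphism fixes an extension.\<close>

lemma fixed_points_intermediate:
  assumes "\<sigma> \<in> Gal L Q3" "intermediate_field L"
  shows "intermediate_field {x \<in> L. \<sigma> x = x}"
proof -
  interpret intermediate_field L by fact
  show ?thesis
    by unfold_locales (use Q3_subset closed GalD[OF assms(1)] in
        \<open>auto simp: Gal_uminus[OF assms] Gal_inverse[OF assms]\<close>)
qed

section \<open>Conjugation in a quadratic extension\<close>

context intermediate_field
begin

context
  fixes s :: q3bar
  assumes s: "s \<notin> F" "s ^ 2 \<in> F"
begin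

text \<open>Two different coefficients of s would make s a quotient of elements of F.\<close>

lemma quadratic_coordinates_unique:
  assumes "a \<in> F" "b \<in> F" "a' \<in> F" "b' \<in> F" "a + b * s = a' + b' * s"
  shows "a = a' \<and> b = b'"
proof -
  have "(b - b') * s = a' - a" using assms(5) by (simp add: algebra_simps)
  hence "b = b'" using s(1) divide_closed[of "a' - a" "b - b'"] diff_closed assms(1-4)
    by (metis eq_iff_diff_eq_0 nonzero_mult_div_cancel_left)
  thus ?thesis using assms(5) by simp
qed

lemma quadratic_extension_intermediate:
  "intermediate_field {a + b * s |a b. a \<in> F \<and> b \<in> F}" (is "intermediate_field ?L")
proof
  have L: "x \<in> ?L" if "a \<in> F" "b \<in> F" "x = a + b * s" for x a b using that by blast
  show "Q3 \<subseteq> ?L" using L[OF _ zero_closed] Q3_subset by auto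
  fix x y assume "x \<in> ?L"
  then obtain a b where x: "a \<in> F" "b \<in> F" "x = a + b * s" by auto
  show "- x \<in> ?L" by (rule L[of "- a" "- b"]) (use x closed in auto)
  show "inverse x \<in> ?L"
  proof (cases "x = 0")
    case True
    thus ?thesis using L[OF zero_closed zero_closed] by simp
  next
    case False
    \<comment> \<open>The norm of x lies in F; uniqueness of coordinates keeps the conjugate, and
      with it the norm, nonzero.\<close>
    define d where "d = a ^ 2 - b ^ 2 * s ^ 2"
    have d: "d = x * (a - b * s)" unfolding d_def x
      by (simp add: algebra_simps power2_eq_square)
    have "a - b * s \<noteq> 0"
    proof
      assume *: "a - b * s = 0"
      hence "a = 0 \<and> - b = 0"
        using quadratic_coordinates_unique[of a "- b" 0 0] x closed by simp
      thus False using False x by simp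
    qed
    hence "inverse x = (a - b * s) / d" using d False \<open>a - b * s \<noteq> 0\<close> by (simp add: inverse_eq_divide)
    hence "inverse x = a / d + (- b / d) * s" by (simp add: diff_divide_distrib)
    moreover have "d \<in> F" unfolding d_def using x s closed by auto
    ultimately show ?thesis using L[of "a / d" "- b / d"] x closed by auto
  qed
  assume "y \<in> ?L"
  then obtain c e where y: "c \<in> F" "e \<in> F" "y = c + e * s" by auto
  show "x + y \<in> ?L"
    by (rule L[of "a + c" "b + e"]) (use x y closed in \<open>auto simp: algebra_simps\<close>)
  show "x * y \<in> ?L"
    by (rule L[of "a * c + b * e * s ^ 2" "a * e + b * c"])
      (use x y s closed in \<open>auto simp: algebra_simps power2_eq_square\<close>)
qed

text \<open>Changing the sign of s respects products because s enters their reduction only through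
  s^2, which lies in F.\<close>

lemma quadratic_conjugation:
  obtains \<sigma> where "\<sigma> \<in> Gal {a + b * s |a b. a \<in> F \<and> b \<in> F} Q3"
    "\<And>a b. a \<in> F \<Longrightarrow> b \<in> F \<Longrightarrow> \<sigma> (a + b * s) = a - b * s"
proof -
  define L where "L = {a + b * s |a b. a \<in> F \<and> b \<in> F}"
  have "\<forall>x\<in>L. \<exists>y. \<exists>a\<in>F. \<exists>b\<in>F. x = a + b * s \<and> y = a - b * s" by (auto simp: L_def)
  then obtain f where f: "\<And>x. x \<in> L \<Longrightarrow> \<exists>a\<in>F. \<exists>b\<in>F. x = a + b * s \<and> f x = a - b * s"
    by metis
  \<comment> \<open>\<open>Gal\<close> asks for extensional functions, so the chosen function is cut
    down to L.\<close>
  define \<sigma> where "\<sigma> = restrict f L"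
  have \<sigma>: "\<sigma> (a + b * s) = a - b * s" if "a \<in> F" "b \<in> F" for a b
  proof -
    have "a + b * s \<in> L" using that by (auto simp: L_def)
    moreover from f[OF this] have "f (a + b * s) = a - b * s"
      using quadratic_coordinates_unique that by metis
    ultimately show ?thesis by (simp add: \<sigma>_def)
  qed
  have \<sigma>': "\<sigma> (a - b * s) = a + b * s" if "a \<in> F" "b \<in> F" for a b
    using \<sigma>[of a "- b"] that closed by simp
  have L': "a - b * s \<in> L" if "a \<in> F" "b \<in> F" for a b
  proof -
    have "a - b * s = a + (- b) * s" by simp
    thus ?thesis using that closed unfolding L_def by blast
  qed
  have "\<sigma> \<in> Gal L Q3"
    unfolding Gal_def
  proof (intro CollectI conjI ballI)
    show "\<sigma> \<in> extensional L" by (simp add: \<sigma>_def)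
    show "bij_betw \<sigma> L L"
    proof (rule bij_betw_byWitness[of _ \<sigma>])
      show "\<forall>x\<in>L. \<sigma> (\<sigma> x) = x" by (auto simp: L_def \<sigma> \<sigma>')
      have "\<sigma> x \<in> L" if "x \<in> L" for x
      proof -
        obtain a b where "a \<in> F" "b \<in> F" "x = a + b * s" using \<open>x \<in> L\<close> by (auto simp: L_def)
        thus ?thesis using L' \<sigma> by simp
      qed
      thus "\<sigma> ` L \<subseteq> L" "\<sigma> ` L \<subseteq> L" by auto
    qed (auto simp: L_def \<sigma> \<sigma>')
    show "\<sigma> x = x" if "x \<in> Q3" for x
      using \<sigma>[of x 0] that Q3_subset closed by auto
    fix x y assume "x \<in> L" "y \<in> L"
    then obtain a b c d where xy: "a \<in> F" "b \<in> F" "x = a + b * s" "c \<in> F" "d \<in> F" "y = c + d * s"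
      by (auto simp: L_def)
    have \<sigma>xy: "\<sigma> x = a - b * s" "\<sigma> y = c - d * s" using xy \<sigma> by simp_all
    have sum: "x + y = (a + c) + (b + d) * s" by (simp add: xy algebra_simps)
    have "\<sigma> (x + y) = (a + c) - (b + d) * s"
      unfolding sum by (rule \<sigma>) (use xy closed in auto)
    thus "\<sigma> (x + y) = \<sigma> x + \<sigma> y" unfolding \<sigma>xy by (simp add: algebra_simps)
    have prod: "x * y = (a * c + b * d * s ^ 2) + (a * d + b * c) * s"
      by (simp add: xy algebra_simps power2_eq_square)
    have "\<sigma> (x * y) = (a * c + b * d * s ^ 2) - (a * d + b * c) * s"
      unfolding prod by (rule \<sigma>) (use xy s closed in auto)
    thus "\<sigma> (x * y) = \<sigma> x * \<sigma> y" unfolding \<sigma>xy by (simp add: algebra_simps power2_eq_square)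
  qed
  thus ?thesis using that \<sigma> unfolding L_def by blast
qed

end

end

section \<open>The fixed field\<close>

text \<open>The residue of -1 at level n is 3^n - 1.\<close>

lemma power_residue_minus_one:
  assumes "\<zeta> ^ (3 ^ n) = (1 :: q3bar)"
  shows "\<zeta> ^ nat (residue (- 1) n) = inverse \<zeta>"
proof -
  have "(- 1 :: int) mod 3 ^ n = 3 ^ n - 1"
    by (rule zmod_minus1) simp
  moreover have "residue (- 1) n = (- 1) mod 3 ^ n"
    using residue_of_int[of "- 1" n] by simp
  ultimately have "Suc (nat (residue (- 1) n)) = 3 ^ n"
    by (simp add: nat_diff_distrib nat_power_eq)
  hence "\<zeta> * \<zeta> ^ nat (residue (- 1) n) = 1" using assms by (metis power_Suc)
  thus ?thesis by (metis inverse_unique)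
qed

context cyclotomic_tower
begin

section \<open>The tower of fields and its union\<close>

lemma u_Suc: "u (Suc n) ^ 3 + 6 * u (Suc n) ^ 2 + 9 * u (Suc n) = u n"
  using joukowsky_cube[OF z_nonzero u_eq, of "Suc n"] by (simp add: z_Suc u_eq[of n])

lemma u_0: "u 0 = - 3"
proof -
  have "z 0 * (z 0 + inverse (z 0)) = - z 0"
    using z_0 by (simp add: distrib_left power2_eq_square eq_neg_iff_add_eq_0 ac_simps)
  hence "z 0 + inverse (z 0) = -1" by (metis mult_cancel_left mult_minus1_right z_nonzero)
  thus ?thesis by (simp add: u_eq)
qed

text \<open>\<open>u n\<close> is a polynomial in \<open>u (Suc n)\<close>.\<close>

lemma Q3_adjoin_u_mono: "m \<le> n \<Longrightarrow> Q3_adjoin {u m} \<subseteq> Q3_adjoin {u n}"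
proof (induction n rule: dec_induct)
  case (step n)
  interpret intermediate_field "Q3_adjoin {u (Suc n)}" by (rule Q3_adjoin_intermediate)
  have "u (Suc n) \<in> Q3_adjoin {u (Suc n)}" using subset_Q3_adjoin by blast
  hence "u n \<in> Q3_adjoin {u (Suc n)}"
    unfolding u_Suc[symmetric, of n] by (intro closed)
  hence "Q3_adjoin {u n} \<subseteq> Q3_adjoin {u (Suc n)}"
    by (intro Q3_adjoin_least Q3_adjoin_intermediate) auto
  thus ?case using step by blast
qed simp

lemma K_inf_eq: "K_inf u = (\<Union>n. Q3_adjoin {u n})"
  unfolding K_inf_def using Q3_adjoin_u_mono[of 0 1] by (auto; metis atLeast_iff le_cases le_zero_eq not_less_eq_eq subsetD)

lemma u_in_K_inf: "u n \<in> K_inf u"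
  unfolding K_inf_eq using subset_Q3_adjoin by blast

lemma K_inf_least:
  assumes "intermediate_field F" "\<And>n. u n \<in> F"
  shows "K_inf u \<subseteq> F"
  unfolding K_inf_eq using Q3_adjoin_least[OF assms(1)] assms(2) by blast

lemma K_inf_intermediate: "intermediate_field (K_inf u)"
proof
  interpret Q: intermediate_field "Q3_adjoin {u n}" for n
    by (rule Q3_adjoin_intermediate)
  have K: "x \<in> K_inf u" if "x \<in> Q3_adjoin {u n}" for x n
    using that unfolding K_inf_eq by blast
  show "Q3 \<subseteq> K_inf u" using K[OF Q.to_ac_closed] by blast
  fix x y assume "x \<in> K_inf u"
  then obtain m where x: "x \<in> Q3_adjoin {u m}" unfolding K_inf_eq by blast
  show "- x \<in> K_inf u" "inverse x \<in> K_inf u"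
    by (rule K[OF Q.uminus_closed[OF x]], rule K[OF Q.inverse_closed[OF x]])
  assume "y \<in> K_inf u"
  then obtain n where y: "y \<in> Q3_adjoin {u n}" unfolding K_inf_eq by blast
  have "x \<in> Q3_adjoin {u (max m n)}" "y \<in> Q3_adjoin {u (max m n)}"
    using x y Q3_adjoin_u_mono[of m "max m n"] Q3_adjoin_u_mono[of n "max m n"] by auto
  thus "x + y \<in> K_inf u" "x * y \<in> K_inf u"
    using K Q.add_closed Q.mult_closed by metis+
qed

text \<open>A square root of -3, since its square is (\<open>u 0\<close> + 2)^2 - 4.\<close>

definition s :: q3bar where "s = z 0 - inverse (z 0)"

text \<open>Difference of cubes: x^3 - y^3 = (x - y)((x + y)^2 - x y), with x y = 1 and x + y =
  \<open>u (Suc n)\<close> + 2. The differences at successive levels thus agree up to factors in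
  \<open>K_inf u\<close>.\<close>

lemma z_minus_inverse:
  "z n - inverse (z n) = (z (Suc n) - inverse (z (Suc n))) * ((u (Suc n) + 2) ^ 2 - 1)"
proof -
  define x y where "x = z (Suc n)" and "y = inverse (z (Suc n))"
  have "x * y = 1" by (simp add: x_def y_def)
  moreover have "(x - y) * ((x + y) ^ 2 - 1) = x ^ 3 - y ^ 3 + (x - y) * (x * y - 1)"
    by (simp add: algebra_simps power2_eq_square power3_eq_cube)
  ultimately show ?thesis
    by (simp add: x_def y_def u_eq[of "Suc n"] power_inverse z_Suc)
qed

lemma z_neq_inverse: "z n - inverse (z n) \<noteq> 0"
proof
  assume "z n - inverse (z n) = 0"
  hence "z n ^ 2 = 1" by (simp add: power2_eq_square field_simps)
  hence "3 ^ Suc n dvd (2::nat)" by (simp only: z_power_eq_1_iff)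
  hence "3 dvd (2::nat)" by (rule dvd_trans[rotated]) simp
  thus False by simp
qed

text \<open>Split \<open>z n\<close> into the parts symmetric and antisymmetric under inversion: the
  first is (\<open>u n\<close> + 2)/2, the second is related to s by
  \<open>z_minus_inverse\<close>.\<close>

lemma z_coordinates:
  "\<exists>a\<in>K_inf u. \<exists>b\<in>K_inf u. z n = a + b * s \<and> inverse (z n) = a - b * s"
proof -
  interpret intermediate_field "K_inf u" by (rule K_inf_intermediate)
  have "\<exists>q\<in>K_inf u. z n - inverse (z n) = q * s"
  proof (induction n)
    case (Suc n)
    then obtain q where q: "q \<in> K_inf u" "z n - inverse (z n) = q * s" by blast
    define t where "t = (u (Suc n) + 2) ^ 2 - 1"
    have "t \<noteq> 0" using z_minus_inverse[of n] z_neq_inverse[of n] by (auto simp: t_def)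
    hence "z (Suc n) - inverse (z (Suc n)) = q / t * s"
      using z_minus_inverse[of n, folded t_def] q(2) by (simp add: eq_divide_eq)
    moreover have "q / t \<in> K_inf u" unfolding t_def using q(1) u_in_K_inf closed by auto
    ultimately show ?case by blast
  qed (auto simp: s_def intro!: bexI[of _ 1] one_closed)
  then obtain q where q: "q \<in> K_inf u" "z n - inverse (z n) = q * s" by blast
  have "z n = ((z n + inverse (z n)) + (z n - inverse (z n))) / 2"
    "inverse (z n) = ((z n + inverse (z n)) - (z n - inverse (z n))) / 2" by simp_all
  hence "z n = (u n + 2) / 2 + q / 2 * s" "inverse (z n) = (u n + 2) / 2 - q / 2 * s"
    unfolding q(2) by (simp_all add: u_eq add_divide_distrib diff_divide_distrib)
  moreover have "(u n + 2) / 2 \<in> K_inf u" "q / 2 \<in> K_inf u"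
    using q(1) u_in_K_inf closed by auto
  ultimately show ?thesis by blast
qed

lemma mu_eq_z_power: "\<zeta> \<in> mu_3inf \<Longrightarrow> \<exists>n k. \<zeta> = z n ^ k"
proof -
  assume "\<zeta> \<in> mu_3inf"
  then obtain n where "\<zeta> ^ (3 ^ n) = 1" unfolding mu_3inf_def by blast
  \<comment> \<open>\<open>z n\<close> has order 3^(n+1), so the exponent is raised by one
    level.\<close>
  hence "(\<zeta> ^ (3 ^ n)) ^ 3 = 1" by simp
  hence "\<zeta> ^ (3 ^ Suc n) = 1" by (simp add: mult.commute flip: power_mult)
  thus ?thesis using root_of_unity_eq_z_power by blast
qed

lemma Q3_adjoin_mu_least:
  assumes "intermediate_field F" "\<And>n. z n \<in> F"
  shows "Q3_adjoin mu_3inf \<subseteq> F"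
proof (rule Q3_adjoin_least)
  interpret intermediate_field F by fact
  show "mu_3inf \<subseteq> F"
  proof
    fix \<zeta> assume "\<zeta> \<in> mu_3inf"
    then obtain n k where "\<zeta> = z n ^ k" using mu_eq_z_power by blast
    thus "\<zeta> \<in> F" using power_closed[OF assms(2)] by simp
  qed
qed fact

lemma z_in_Q3_adjoin_mu: "z n \<in> Q3_adjoin mu_3inf"
  using z_in_mu subset_Q3_adjoin by blast

lemma K_inf_subset_Q3_adjoin_mu: "K_inf u \<subseteq> Q3_adjoin mu_3inf"
proof (rule K_inf_least)
  show "intermediate_field (Q3_adjoin mu_3inf)" by (rule Q3_adjoin_intermediate)
  then interpret intermediate_field "Q3_adjoin mu_3inf" .
  show "u n \<in> Q3_adjoin mu_3inf" for n
    unfolding u_eq using z_in_Q3_adjoin_mu closed by auto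
qed

text \<open>Such an automorphism sends \<open>z n\<close> to itself or to its inverse, and either
  way fixes the sum of the two.\<close>

lemma K_inf_subset_fixed:
  assumes \<sigma>: "\<sigma> \<in> Gal (Q3_adjoin mu_3inf) Q3" "chi_cyc \<sigma> \<in> {1, -1}"
  shows "K_inf u \<subseteq> {x \<in> Q3_adjoin mu_3inf. \<sigma> x = x}"
proof (rule K_inf_least)
  let ?L = "Q3_adjoin mu_3inf"
  have L: "intermediate_field ?L" by (rule Q3_adjoin_intermediate)
  then interpret intermediate_field ?L .
  interpret fx: intermediate_field "{x \<in> ?L. \<sigma> x = x}"
    by (rule fixed_points_intermediate[OF \<sigma>(1) L])
  show "intermediate_field {x \<in> ?L. \<sigma> x = x}" by (rule fx.intermediate_field_axioms)
  fix n
  have \<sigma>z: "\<sigma> (z n) = z n ^ nat (residue (chi_cyc \<sigma>) (Suc n))"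
    using cyclotomic_exponent_Gal[OF \<sigma>(1) subset_Q3_adjoin] z_power_Suc
    unfolding cyclotomic_exponent_def by blast
  have inv: "\<sigma> (inverse (z n)) = inverse (\<sigma> (z n))"
    by (rule Gal_inverse[OF \<sigma>(1) L z_in_Q3_adjoin_mu])
  have zL: "z n \<in> ?L" "inverse (z n) \<in> ?L" using z_in_Q3_adjoin_mu closed by auto
  have "\<sigma> (z n) = z n \<or> \<sigma> (z n) = inverse (z n)"
  proof (cases "chi_cyc \<sigma> = 1")
    case True
    have "(1 :: int) mod 3 ^ Suc n = 1" by (rule mod_pos_pos_trivial) (use one_less_power[of "3 :: int" "Suc n"] in auto)
    hence "nat (residue (chi_cyc \<sigma>) (Suc n)) = 1"
      unfolding True one_z3.rep_eq by simp
    thus ?thesis using \<sigma>z by simp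
  next
    case False
    thus ?thesis using \<sigma>(2) \<sigma>z power_residue_minus_one[OF z_power_Suc, of n] by auto
  qed
  hence "\<sigma> (z n + inverse (z n)) = z n + inverse (z n)"
    using GalD(3)[OF \<sigma>(1) zL] inv by auto
  hence "z n + inverse (z n) \<in> {x \<in> ?L. \<sigma> x = x}" using zL closed by auto
  thus "u n \<in> {x \<in> ?L. \<sigma> x = x}" unfolding u_eq
    by (rule fx.diff_closed[OF _ fx.numeral_closed])
qed

lemma K_inf_eq_fixed_field:
  "K_inf u = fixed_field (Q3_adjoin mu_3inf)
     {\<sigma> \<in> Gal (Q3_adjoin mu_3inf) Q3. chi_cyc \<sigma> \<in> {1, -1}}" (is "_ = fixed_field ?L ?H")
proof
  show "K_inf u \<subseteq> fixed_field ?L ?H"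
    using K_inf_subset_fixed K_inf_subset_Q3_adjoin_mu unfolding fixed_field_def by blast
  interpret K: intermediate_field "K_inf u" by (rule K_inf_intermediate)
  interpret L: intermediate_field ?L by (rule Q3_adjoin_intermediate)
  show "fixed_field ?L ?H \<subseteq> K_inf u"
  proof (cases "s \<in> K_inf u")
    \<comment> \<open>Here every \<open>z n\<close> lies in \<open>K_inf u\<close>, so the
      cyclotomic field collapses to it.\<close>
    case True
    have "z n \<in> K_inf u" for n using z_coordinates[of n] True K.closed(5,6) by metis
    hence "?L \<subseteq> K_inf u" by (intro Q3_adjoin_mu_least K.intermediate_field_axioms)
    thus ?thesis unfolding fixed_field_def by blast
  next
    case False
    have "s ^ 2 = (z 0 + inverse (z 0)) ^ 2 - 4 * (z 0 * inverse (z 0))"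
      unfolding s_def by (simp add: algebra_simps power2_eq_square)
    also have "\<dots> = (u 0 + 2) ^ 2 - 4" by (simp add: u_eq)
    also have "\<dots> \<in> K_inf u" using u_in_K_inf K.closed by auto
    finally have s2: "s ^ 2 \<in> K_inf u" .
    note quad = False s2
    \<comment> \<open>This quadratic extension is shown to be the whole cyclotomic field, which
      makes the conjugation an element of its Galois group.\<close>
    let ?M = "{a + b * s |a b. a \<in> K_inf u \<and> b \<in> K_inf u}"
    obtain \<sigma> where \<sigma>: "\<sigma> \<in> Gal ?M Q3"
      "\<And>a b. a \<in> K_inf u \<Longrightarrow> b \<in> K_inf u \<Longrightarrow> \<sigma> (a + b * s) = a - b * s"
      using K.quadratic_conjugation[OF quad] by blast
    have LM: "?L \<subseteq> ?M"
    proof (rule Q3_adjoin_mu_least)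
      show "intermediate_field ?M" by (rule K.quadratic_extension_intermediate[OF quad])
      show "z n \<in> ?M" for n using z_coordinates[of n] by blast
    qed
    have "s \<in> ?L" unfolding s_def using z_in_Q3_adjoin_mu L.closed by auto
    hence "?M \<subseteq> ?L"
      using K_inf_subset_Q3_adjoin_mu by (auto intro!: L.add_closed L.mult_closed)
    hence M: "?M = ?L" using LM by blast
    have \<sigma>z: "\<sigma> (z n) = inverse (z n)" for n using z_coordinates[of n] \<sigma>(2) by metis
    have "cyclotomic_exponent \<sigma> (- 1)"
      unfolding cyclotomic_exponent_def
    proof (intro conjI allI impI)
      fix n \<zeta> assume \<zeta>: "\<zeta> ^ (3 ^ n) = (1 :: q3bar)"
      \<comment> \<open>Some exponent for \<sigma> exists already; inserting it transports the
        inversion from \<open>z m\<close> to its powers.\<close>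
      have exp: "\<sigma> \<xi> = \<xi> ^ nat (residue (chi_cyc \<sigma>) m)" if "\<xi> ^ (3 ^ m) = 1" for \<xi> m
        using cyclotomic_exponent_Gal[OF \<sigma>(1)[unfolded M] subset_Q3_adjoin] that
        unfolding cyclotomic_exponent_def by blast
      have "\<zeta> \<in> mu_3inf" using \<zeta> unfolding mu_3inf_def by blast
      then obtain m k where \<zeta>_eq: "\<zeta> = z m ^ k" using mu_eq_z_power by blast
      have "\<zeta> ^ (3 ^ Suc m) = (z m ^ (3 ^ Suc m)) ^ k"
        unfolding \<zeta>_eq by (simp only: mult.commute flip: power_mult)
      hence "\<sigma> \<zeta> = \<zeta> ^ nat (residue (chi_cyc \<sigma>) (Suc m))"
        by (intro exp) (simp only: z_power_Suc power_one)
      also have "\<dots> = (z m ^ nat (residue (chi_cyc \<sigma>) (Suc m))) ^ k"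
        unfolding \<zeta>_eq by (simp only: mult.commute flip: power_mult)
      also have "\<dots> = inverse (z m) ^ k" using exp[OF z_power_Suc] \<sigma>z by metis
      also have "\<dots> = inverse \<zeta>" by (simp add: \<zeta>_eq power_inverse)
      finally show "\<sigma> \<zeta> = \<zeta> ^ nat (residue (- 1) n)"
        by (simp only: power_residue_minus_one[OF \<zeta>])
    qed simp
    hence "\<sigma> \<in> ?H" using \<sigma>(1) chi_cyc_eqI unfolding M by auto
    show ?thesis
    proof
      fix x assume "x \<in> fixed_field ?L ?H"
      hence x: "x \<in> ?L" "\<sigma> x = x" using \<open>\<sigma> \<in> ?H\<close> unfolding fixed_field_def by auto
      then obtain a b where ab: "a \<in> K_inf u" "b \<in> K_inf u" "x = a + b * s" using LM by blast
      have "a + b * s = a - b * s" using x(2) \<sigma>(2)[OF ab(1,2)] ab(3) by simp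
      hence "2 * (b * s) = 0" by simp
      moreover have "s \<noteq> 0" using False K.zero_closed by auto
      ultimately show "x \<in> K_inf u" using ab by simp
    qed
  qed
qed

end

section \<open>The coefficients of the Coleman power series\<close>

lemma integral_root_of_unity:
  assumes "x ^ n = 1" "n > 0"
  shows "integral_z3 x"
proof -
  have "lead_coeff (monom 1 n - 1 :: z3 poly) = 1"
  proof -
    have "coeff (monom 1 n - 1 :: z3 poly) n = 1" using assms(2) by simp
    moreover have "degree (monom 1 n - 1 :: z3 poly) \<le> n"
      by (intro degree_diff_le degree_monom_le) simp
    ultimately show ?thesis using le_degree[of "monom 1 n - 1 :: z3 poly" n] by simp
  qed
  moreover have "map_poly of_z3 (monom 1 n - 1) = monom 1 n - 1"
    by (rule poly_eqI) (simp add: coeff_map_poly coeff_pCons one_pCons split: nat.split)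
  hence "poly (map_poly of_z3 (monom 1 n - 1)) x = 0"
    using assms(1) by (simp add: poly_monom)
  ultimately show ?thesis unfolding integral_z3_def by blast
qed

lemma prod_diff_of_nat_eq_binomial:
  "(\<Prod>i<j. of_nat m - of_nat i :: 'a :: comm_ring_1) = of_nat (fact j * (m choose j))"
proof (induction j)
  case (Suc j)
  show ?case
  proof (cases "j \<le> m")
    case True
    have "Suc j * (m choose Suc j) = (m - j) * (m choose j)"
      by (metis binomial_absorb_comp binomial_absorption)
    hence "fact j * (Suc j * (m choose Suc j)) = fact j * ((m - j) * (m choose j))" by simp
    hence eq: "fact (Suc j) * (m choose Suc j) = fact j * (m choose j) * (m - j)"
      by (simp only: fact_Suc of_nat_id mult_ac)
    show ?thesis
      unfolding eq prod.lessThan_Suc Suc using True by (simp add: of_nat_diff)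
  next
    case False
    thus ?thesis using Suc by (simp add: binomial_eq_0)
  qed
qed simp

lemma dvd_prod_diff:
  fixes f g :: "nat \<Rightarrow> 'a :: comm_ring_1"
  assumes "\<And>i. c dvd f i - g i"
  shows "c dvd (\<Prod>i<n. f i) - (\<Prod>i<n. g i)"
proof (induction n)
  case (Suc n)
  have "(\<Prod>i<Suc n. f i) - (\<Prod>i<Suc n. g i) =
    ((\<Prod>i<n. f i) - (\<Prod>i<n. g i)) * f n + (\<Prod>i<n. g i) * (f n - g n)"
    by (simp add: algebra_simps)
  thus ?case using Suc assms by simp
qed simp

lemma z3_nat_approx:
  fixes a :: z3
  obtains m where "m > 0" "3 ^ n dvd a - of_nat m"
proof
  \<comment> \<open>The summand 3^n makes m positive without changing its class.\<close>
  define m where "m = nat (residue a n) + 3 ^ n"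
  show "m > 0" by (simp add: m_def)
  have "of_nat (nat (residue a n)) = (of_int (residue a n) :: z3)"
    using residue_range(1)[of a n] by simp
  hence "a - of_nat m = (a - of_int (residue a n)) - 3 ^ n"
    by (simp add: m_def)
  thus "3 ^ n dvd a - of_nat m"
    using three_power_dvd_diff_residue[of n a] by (metis dvd_diff dvd_refl)
qed

text \<open>
  For positive integers \<open>a\<close>, the polynomial in \<open>T = x + 1/x - 2\<close> that represents
  \<open>x\<^sup>a + x\<^sup>-\<^sup>a\<close> has \<open>T\<^sup>k\<close>-coefficient \<open>C(a+k, 2k) + C(a+k-1, 2k)\<close>. Below is \<open>(2k)!\<close> times this
  number; it makes sense for 3-adic \<open>a\<close>, and by density of the integers it remains
  divisible by \<open>(2k)!\<close>.
\<close>

definition col_numerator :: "z3 \<Rightarrow> nat \<Rightarrow> z3" where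
  "col_numerator a k = (\<Prod>i<2*k. a + of_nat k - of_nat i) + (\<Prod>i<2*k. a + of_nat k - 1 - of_nat i)"

text \<open>For m > 0 these are the coefficients of 2 T_m(1 + y/2) in y, where T_m is the Chebyshev
  polynomial.\<close>

definition col_coeff_nat :: "nat \<Rightarrow> nat \<Rightarrow> nat" where
  "col_coeff_nat m k = ((m + k) choose (2 * k)) + ((m + k - 1) choose (2 * k))"

text \<open>Positivity of m makes truncated subtraction in m + k - 1 agree with subtraction in
  \<open>z3\<close>.\<close>

lemma col_numerator_of_nat:
  assumes "m > 0"
  shows "col_numerator (of_nat m) k = of_nat (fact (2 * k)) * of_nat (col_coeff_nat m k)"
proof -
  have eq: "of_nat (m + k - 1) = (of_nat m + of_nat k - 1 :: z3)"
    using assms by (simp add: of_nat_diff)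
  show ?thesis
    using prod_diff_of_nat_eq_binomial[of "m + k" "2 * k", where 'a = z3]
      prod_diff_of_nat_eq_binomial[of "m + k - 1" "2 * k", where 'a = z3]
    unfolding col_numerator_def col_coeff_nat_def eq by (simp add: distrib_left)
qed

lemma col_numerator_cong: "c dvd a - b \<Longrightarrow> c dvd col_numerator a k - col_numerator b k"
proof -
  assume c: "c dvd a - b"
  have "c dvd (\<Prod>i<2*k. a + of_nat k - of_nat i) - (\<Prod>i<2*k. b + of_nat k - of_nat i)"
    "c dvd (\<Prod>i<2*k. a + of_nat k - 1 - of_nat i) - (\<Prod>i<2*k. b + of_nat k - 1 - of_nat i)"
    using c by (intro dvd_prod_diff; simp)+
  hence "c dvd ((\<Prod>i<2*k. a + of_nat k - of_nat i) - (\<Prod>i<2*k. b + of_nat k - of_nat i)) +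
    ((\<Prod>i<2*k. a + of_nat k - 1 - of_nat i) - (\<Prod>i<2*k. b + of_nat k - 1 - of_nat i))"
    by (rule dvd_add)
  thus ?thesis by (simp add: col_numerator_def algebra_simps)
qed

text \<open>Up to a unit a is a power of 3; divisibility by a becomes a congruence that natural
  approximations can test.\<close>

lemma z3_nonzero_dvd_power:
  fixes a :: z3
  assumes "a \<noteq> 0"
  shows "\<exists>e. \<forall>x. a dvd x \<longleftrightarrow> 3 ^ e dvd x"
proof -
  obtain e b where eb: "a = 3 ^ e * b" "b dvd 1" using z3_nonzero_factor[OF assms] .
  then obtain b' where b': "b * b' = 1" by (metis dvd_def)
  have "3 ^ e = a * b'" by (simp add: eb(1) mult.assoc b')
  hence "a dvd x \<longleftrightarrow> 3 ^ e dvd x" for x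
    using eb(1) by (metis dvd_trans dvd_triv_left)
  thus ?thesis by blast
qed

text \<open>The claim holds at positive integers, and one of them is close enough to a.\<close>

lemma fact_dvd_col_numerator: "of_nat (fact (2 * k)) dvd col_numerator a k"
proof -
  have "of_nat (fact (2 * k)) \<noteq> (0 :: z3)" by (simp only: of_nat_eq_0_iff fact_nonzero) simp
  then obtain e where e: "\<And>x :: z3. of_nat (fact (2 * k)) dvd x \<longleftrightarrow> 3 ^ e dvd x"
    using z3_nonzero_dvd_power by blast
  obtain m where m: "m > 0" "3 ^ e dvd a - of_nat m" by (rule z3_nat_approx)
  have "3 ^ e dvd (col_numerator a k - col_numerator (of_nat m) k) + col_numerator (of_nat m) k"
    using col_numerator_cong[OF m(2)] col_numerator_of_nat[OF m(1)]
    unfolding e[symmetric] by (intro dvd_add) auto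
  thus ?thesis unfolding e by simp
qed

text \<open>The chosen quotient is unique because \<open>z3\<close> is an integral domain of
  characteristic 0.\<close>

definition col_coeff :: "z3 \<Rightarrow> nat \<Rightarrow> z3" where
  "col_coeff a k = (SOME c. of_nat (fact (2 * k)) * c = col_numerator a k)"

lemma col_coeff: "of_nat (fact (2 * k)) * col_coeff a k = col_numerator a k"
  unfolding col_coeff_def by (rule someI_ex) (metis fact_dvd_col_numerator dvd_def)

lemma col_coeff_0: "col_coeff a 0 = 2"
  using col_coeff[of 0 a] by (simp add: col_numerator_def)

text \<open>The numerator is (a + 1) a + a (a - 1); this coefficient becomes the value of
  \<open>eta\<close>.\<close>

lemma col_coeff_1: "col_coeff a 1 = a ^ 2"
proof -
  have "2 * col_coeff a 1 = 2 * a ^ 2"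
    using col_coeff[of 1 a]
    by (simp add: col_numerator_def fact_2 numeral_2_eq_2 algebra_simps power2_eq_square)
  thus ?thesis by (metis mult_cancel_left zero_neq_numeral)
qed

text \<open>Dividing by (2k)! costs finitely many powers of 3; E bounds this loss for all k below K,
  independently of the precision M.\<close>

lemma col_coeff_approx:
  "\<exists>E. \<forall>M m k. k < K \<longrightarrow> m > 0 \<longrightarrow> 3 ^ (M + E) dvd a - of_nat m \<longrightarrow>
    3 ^ M dvd col_coeff a k - of_nat (col_coeff_nat m k)"
proof -
  have nz: "of_nat (fact (2 * k)) \<noteq> (0 :: z3)" for k
    by (simp only: of_nat_eq_0_iff fact_nonzero) simp
  have "\<exists>e. of_nat (fact (2 * k)) dvd (3 ^ e :: z3)" for k
    using z3_nonzero_dvd_power[OF nz[of k]] by (metis dvd_refl)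
  then obtain e where e: "\<And>k. of_nat (fact (2 * k)) dvd (3 ^ e k :: z3)" by metis
  define E where "E = (\<Sum>k<K. e k)"
  have "3 ^ M dvd col_coeff a k - of_nat (col_coeff_nat m k)"
    if k: "k < K" and m: "m > 0" "3 ^ (M + E) dvd a - of_nat m" for M m k
  proof -
    have "e k \<le> E" unfolding E_def using k by (intro member_le_sum) auto
    hence "of_nat (fact (2 * k)) dvd (3 ^ E :: z3)"
      using e[of k] le_imp_power_dvd dvd_trans by blast
    hence "3 ^ M * of_nat (fact (2 * k)) dvd (3 ^ (M + E) :: z3)"
      by (simp add: power_add mult_dvd_mono)
    also have "\<dots> dvd col_numerator a k - col_numerator (of_nat m) k"
      by (rule col_numerator_cong[OF m(2)])
    also have "\<dots> = of_nat (fact (2 * k)) * (col_coeff a k - of_nat (col_coeff_nat m k))"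
      unfolding col_numerator_of_nat[OF m(1)] right_diff_distrib col_coeff ..
    finally obtain y where
      "of_nat (fact (2 * k)) * (col_coeff a k - of_nat (col_coeff_nat m k)) =
       3 ^ M * of_nat (fact (2 * k)) * y" by (rule dvdE)
    hence "of_nat (fact (2 * k)) * (col_coeff a k - of_nat (col_coeff_nat m k)) =
       of_nat (fact (2 * k)) * (3 ^ M * y)" by (simp only: mult_ac)
    hence "col_coeff a k - of_nat (col_coeff_nat m k) = 3 ^ M * y"
      using nz mult_cancel_left by blast
    thus ?thesis by simp
  qed
  thus ?thesis by blast
qed

text \<open>Pascal's rule applied repeatedly; this is the coefficient form of A(m+2) - 2 A(m+1) +
  A(m) = y A(m+1).\<close>

lemma choose_second_difference:
  "(m + 2 + Suc k choose (2 * Suc k)) + (m + Suc k choose (2 * Suc k)) =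
   2 * (m + 1 + Suc k choose (2 * Suc k)) + (m + 1 + k choose (2 * k))"
  by (simp add: algebra_simps)

text \<open>Both sides satisfy the recurrence with multiplier y + 2 = x + 1/x and agree for m = 0
  and m = 1. The factor x + 1 clears the denominator of the closed form.\<close>

lemma sum_choose_joukowsky:
  fixes x y :: "'a :: field"
  assumes x: "x \<noteq> 0" and y: "y = x + inverse x - 2" and "m < N"
  shows "(\<Sum>k<N. of_nat (m + k choose (2 * k)) * y ^ k) * (x + 1) = x ^ Suc m + inverse x ^ m"
  using assms(3)
proof (induction m rule: induct_nat_012)
  case 0
  have "(\<Sum>k<N. of_nat (0 + k choose (2 * k)) * y ^ k) = (\<Sum>k\<in>{0}. of_nat (0 + k choose (2 * k)) * y ^ k)"
    using 0 by (intro sum.mono_neutral_right) (auto simp: binomial_eq_0)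
  thus ?case by simp
next
  case 1
  have "(\<Sum>k<N. of_nat (Suc 0 + k choose (2 * k)) * y ^ k) =
    (\<Sum>k\<in>{0,1}. of_nat (Suc 0 + k choose (2 * k)) * y ^ k)"
    using 1 by (intro sum.mono_neutral_right) (auto simp: binomial_eq_0)
  also have "\<dots> = 1 + y" by (simp add: numeral_2_eq_2)
  finally have sum: "(\<Sum>k<N. of_nat (Suc 0 + k choose (2 * k)) * y ^ k) = 1 + y" .
  show ?case unfolding sum using x by (simp add: y field_simps)
next
  case (ge2 m)
  have cancel: "x * (inverse x * t) = t" for t
    using x by (simp flip: mult.assoc)
  define A where "A i = (\<Sum>k<N. of_nat (i + k choose (2 * k)) * y ^ k)" for i
  obtain N' where N': "N = Suc N'" "N' > m" using ge2.prems by (cases N) auto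
  have split: "A i = 1 + (\<Sum>k<N'. of_nat (i + Suc k choose (2 * Suc k)) * y ^ Suc k)" for i
    unfolding A_def N'(1) sum.lessThan_Suc_shift by simp
  have "A (m + 2) + A m = 2 * A (m + 1) + (\<Sum>k<N'. of_nat (m + 1 + k choose (2 * k)) * y ^ Suc k)"
  proof -
    have "A (m + 2) + A m = 2 + (\<Sum>k<N'. of_nat ((m + 2 + Suc k choose (2 * Suc k)) +
        (m + Suc k choose (2 * Suc k))) * y ^ Suc k)"
      unfolding split of_nat_add distrib_right sum.distrib by simp
    also have "\<dots> = 2 + (\<Sum>k<N'. 2 * (of_nat (m + 1 + Suc k choose (2 * Suc k)) * y ^ Suc k) +
        of_nat (m + 1 + k choose (2 * k)) * y ^ Suc k)"
      unfolding choose_second_difference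
      by (simp only: of_nat_add of_nat_mult of_nat_numeral distrib_right mult.assoc)
    finally show ?thesis
      unfolding split sum.distrib sum_distrib_left[symmetric] by (simp add: algebra_simps)
  qed
  also have "(\<Sum>k<N'. of_nat (m + 1 + k choose (2 * k)) * y ^ Suc k) = y * A (m + 1)"
  proof -
    \<comment> \<open>The top term vanishes because m + 1 < N'.\<close>
    have "m + 1 + N' choose (2 * N') = 0"
      using ge2.prems N' by (intro binomial_eq_0) simp
    hence last: "of_nat (m + 1 + N' choose (2 * N')) = (0 :: 'a)" by (simp only: of_nat_0)
    show ?thesis unfolding A_def N'(1) sum.lessThan_Suc last
      by (simp add: sum_distrib_left mult_ac)
  qed
  finally have "A (m + 2) = (y + 2) * A (m + 1) - A m" by (simp add: algebra_simps)
  also have "y + 2 = x + inverse x" by (simp add: y)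
  finally have rec: "A (m + 2) * (x + 1) =
    (x + inverse x) * (A (m + 1) * (x + 1)) - A m * (x + 1)"
    by (simp only: left_diff_distrib mult.assoc)
  have IH: "A m * (x + 1) = x ^ Suc m + inverse x ^ m"
    "A (m + 1) * (x + 1) = x ^ Suc (Suc m) + inverse x ^ Suc m"
    using ge2 unfolding A_def by simp_all
  have "A (m + 2) * (x + 1) = x ^ Suc (Suc (Suc m)) + inverse x ^ Suc (Suc m)"
    unfolding rec IH by (simp add: algebra_simps cancel)
  thus ?case unfolding A_def by simp
qed

text \<open>The closed forms for m and m - 1 add up to a multiple of x + 1, which cancels.\<close>

lemma sum_col_coeff_nat:
  fixes x y :: "'a :: field"
  assumes "x \<noteq> 0" "x + 1 \<noteq> 0" "y = x + inverse x - 2" "0 < m" "m < N"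
  shows "(\<Sum>k<N. of_nat (col_coeff_nat m k) * y ^ k) = x ^ m + inverse x ^ m"
proof -
  have cancel: "x * (inverse x * t) = t" for t
    using assms(1) by (simp flip: mult.assoc)
  obtain l where l: "m = Suc l" using assms(4) by (cases m) auto
  have "(\<Sum>k<N. of_nat (col_coeff_nat m k) * y ^ k) * (x + 1) =
    (\<Sum>k<N. of_nat (m + k choose (2 * k)) * y ^ k) * (x + 1) +
    (\<Sum>k<N. of_nat (l + k choose (2 * k)) * y ^ k) * (x + 1)"
    unfolding col_coeff_nat_def l by (simp add: distrib_right sum.distrib)
  also have "\<dots> = (x ^ Suc m + inverse x ^ m) + (x ^ Suc l + inverse x ^ l)"
    using sum_choose_joukowsky[OF assms(1,3,5)] sum_choose_joukowsky[OF assms(1,3), of l N]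
      assms(5) l by (simp only: Suc_lessD)
  also have "\<dots> = (x ^ m + inverse x ^ m) * (x + 1)"
    by (simp add: l algebra_simps cancel)
  finally show ?thesis using assms(2) by simp
qed

section \<open>Values of power series along the tower\<close>

text \<open>Valuation at least m, normalised by v(3) = 1.\<close>

definition three_power_multiple :: "nat \<Rightarrow> q3bar \<Rightarrow> bool" where
  "three_power_multiple m x \<longleftrightarrow> (\<exists>y. integral_z3 y \<and> x = 3 ^ m * y)"

lemma tendsto_3adic_iff:
  "tendsto_3adic f l \<longleftrightarrow> (\<forall>m. \<forall>\<^sub>F n in sequentially. three_power_multiple m (f n - l))"
  unfolding tendsto_3adic_def three_power_multiple_def ..

lemma three_power_multiple_0 [simp]: "three_power_multiple m 0"
  unfolding three_power_multiple_def by (rule exI[of _ 0]) simp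

lemma three_power_multiple_add:
  "three_power_multiple m x \<Longrightarrow> three_power_multiple m y \<Longrightarrow> three_power_multiple m (x + y)"
  unfolding three_power_multiple_def by (metis distrib_left integral_z3_add)

lemma three_power_multiple_diff:
  "three_power_multiple m x \<Longrightarrow> three_power_multiple m y \<Longrightarrow> three_power_multiple m (x - y)"
  unfolding three_power_multiple_def by (metis right_diff_distrib integral_z3_diff)

lemma three_power_multiple_mult:
  "three_power_multiple m x \<Longrightarrow> integral_z3 y \<Longrightarrow> three_power_multiple m (x * y)"
  unfolding three_power_multiple_def by (metis mult.assoc integral_z3_mult)

lemma three_power_multiple_sum:
  "(\<And>i. i \<in> A \<Longrightarrow> three_power_multiple m (f i)) \<Longrightarrow> three_power_multiple m (\<Sum>i\<in>A. f i)"
  by (induction A rule: infinite_finite_induct) (auto intro: three_power_multiple_add)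

lemma three_power_multiple_of_z3: "3 ^ m dvd a \<Longrightarrow> three_power_multiple m (of_z3 a)"
  unfolding three_power_multiple_def by (elim dvdE) (metis integral_of_z3 of_z3_mult of_z3_numeral of_z3_power)

lemma fps_has_value_diff:
  assumes "fps_has_value f x v" "fps_has_value g x w"
  shows "fps_has_value (f - g) x (v - w)"
  unfolding fps_has_value_def tendsto_3adic_iff
proof
  fix m
  have "\<forall>\<^sub>F N in sequentially. three_power_multiple m ((\<Sum>k<N. of_z3 (fps_nth f k) * x ^ k) - v)"
    "\<forall>\<^sub>F N in sequentially. three_power_multiple m ((\<Sum>k<N. of_z3 (fps_nth g k) * x ^ k) - w)"
    using assms unfolding fps_has_value_def tendsto_3adic_iff by blast+
  thus "\<forall>\<^sub>F N in sequentially. three_power_multiple m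
    ((\<Sum>k<N. of_z3 (fps_nth (f - g) k) * x ^ k) - (v - w))"
  proof eventually_elim
    case (elim N)
    have eq: "(\<Sum>k<N. of_z3 (fps_nth (f - g) k) * x ^ k) - (v - w) =
      ((\<Sum>k<N. of_z3 (fps_nth f k) * x ^ k) - v) - ((\<Sum>k<N. of_z3 (fps_nth g k) * x ^ k) - w)"
      by (simp add: sum_subtractf left_diff_distrib)
    show ?case unfolding eq by (rule three_power_multiple_diff[OF elim])
  qed
qed

lemma sum_lessThan_add:
  fixes f :: "nat \<Rightarrow> 'a :: comm_monoid_add"
  shows "(\<Sum>k<m + n. f k) = (\<Sum>k<m. f k) + (\<Sum>k<n. f (m + k))"
  by (induction n) (simp_all add: add.assoc)

context cyclotomic_tower
begin

section \<open>Integrality and valuation of the \<open>u n\<close>\<close>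

lemma integral_z: "integral_z3 (z n)"
  by (rule integral_root_of_unity[OF z_power_Suc]) simp

lemma integral_u: "integral_z3 (u n)"
proof -
  have "inverse (z n) ^ (3 ^ Suc n) = 1" by (simp only: power_inverse z_power_Suc inverse_1)
  hence "integral_z3 (inverse (z n))" by (rule integral_root_of_unity) simp
  thus ?thesis unfolding u_eq by (intro integral_z3_intros integral_z)
qed

text \<open>
  Normalising \<open>v(3) = 1\<close>, this says \<open>v(u\<^sub>n) = 1/3\<^sup>n\<close>. It follows from
  \<open>u\<^sub>n = u\<^sub>n\<^sub>+\<^sub>1\<^sup>3 (1 + 3/u\<^sub>n\<^sub>+\<^sub>1)\<^sup>2\<close>, where \<open>3/u\<^sub>n\<^sub>+\<^sub>1\<close> is integral with square divisible by \<open>3\<close>.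
\<close>

lemma u_power_associated_three:
  "\<exists>\<epsilon> \<epsilon>'. integral_z3 \<epsilon> \<and> integral_z3 \<epsilon>' \<and> \<epsilon> * \<epsilon>' = 1 \<and> u n ^ (3 ^ n) = 3 * \<epsilon>"
proof (induction n)
  case 0
  have "integral_z3 (- 1)" by (intro integral_z3_intros)
  thus ?case by (intro exI[of _ "-1"]) (simp add: u_0)
next
  case (Suc n)
  then obtain \<epsilon> \<epsilon>' where \<epsilon>: "integral_z3 \<epsilon>" "integral_z3 \<epsilon>'" "\<epsilon> * \<epsilon>' = 1" "u n ^ (3 ^ n) = 3 * \<epsilon>"
    by blast
  define w where "w = u (Suc n)"
  have w: "integral_z3 w" by (simp add: w_def integral_u)
  have un: "u n = w * (w + 3) ^ 2"
    unfolding w_def u_Suc[of n, symmetric] by (simp add: algebra_simps power2_eq_square power3_eq_cube)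
  \<comment> \<open>This is 3 / \<open>u n\<close>, written without division so that its integrality
    is visible.\<close>
  define c where "c = u n ^ (3 ^ n - 1) * \<epsilon>'"
  have c: "integral_z3 c" unfolding c_def by (intro integral_z3_intros \<epsilon> integral_u)
  have "u n * c = u n ^ (3 ^ n) * \<epsilon>'"
    unfolding c_def by (subst (3) power_minus_mult[symmetric]) (simp_all add: mult_ac)
  hence uc: "u n * c = 3" using \<epsilon> by simp
  \<comment> \<open>This is 3 / w.\<close>
  define v where "v = (w + 3) ^ 2 * c"
  have v: "integral_z3 v" unfolding v_def by (intro integral_z3_intros w c)
  have wv: "w * v = 3" using uc by (simp add: v_def un mult.assoc)
  have "v ^ 2 = 3 * ((w + 6 + 3 * v) * c)"
  proof -
    have "(w + 3) ^ 2 = w * w + 6 * w + 3 * (w * v)"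
      unfolding wv by (simp add: algebra_simps power2_eq_square)
    also have "\<dots> = w * (w + 6 + 3 * v)" by (simp add: algebra_simps)
    finally have "v = w * ((w + 6 + 3 * v) * c)" by (simp add: v_def)
    hence "v * v = (w * v) * ((w + 6 + 3 * v) * c)" by (metis mult.assoc mult.commute)
    thus ?thesis by (simp add: wv power2_eq_square)
  qed
  moreover have "integral_z3 ((w + 6 + 3 * v) * c)" by (intro integral_z3_intros w v c)
  ultimately obtain \<eta> where \<eta>: "integral_z3 \<eta>" "(1 + v) * \<eta> = 1"
    using integral_z3_inverse_one_plus[OF v] by metis
  have "w + 3 = w * (1 + v)" using wv by (simp add: distrib_left)
  hence "u n = w ^ 3 * (1 + v) ^ 2" unfolding un by (simp add: power_mult_distrib power2_eq_square power3_eq_cube)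
  hence "u n * \<eta> ^ 2 = w ^ 3 * ((1 + v) * \<eta>) ^ 2" by (simp add: power_mult_distrib)
  hence w3: "w ^ 3 = u n * \<eta> ^ 2" using \<eta> by simp
  have "w ^ (3 ^ Suc n) = (w ^ 3) ^ (3 ^ n)" by (simp add: power_mult)
  also have "\<dots> = 3 * (\<epsilon> * (\<eta> ^ 2) ^ (3 ^ n))"
    unfolding w3 power_mult_distrib \<epsilon>(4) by (simp add: mult.assoc)
  finally have "w ^ (3 ^ Suc n) = 3 * (\<epsilon> * (\<eta> ^ 2) ^ (3 ^ n))" .
  moreover have "(\<epsilon> * (\<eta> ^ 2) ^ (3 ^ n)) * (\<epsilon>' * ((1 + v) ^ 2) ^ (3 ^ n)) =
    (\<epsilon> * \<epsilon>') * (((1 + v) * \<eta>) ^ 2) ^ (3 ^ n)"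
    by (simp add: power_mult_distrib mult_ac)
  hence "(\<epsilon> * (\<eta> ^ 2) ^ (3 ^ n)) * (\<epsilon>' * ((1 + v) ^ 2) ^ (3 ^ n)) = 1"
    using \<epsilon>(3) \<eta>(2) by simp
  moreover have "integral_z3 (\<epsilon> * (\<eta> ^ 2) ^ (3 ^ n))" "integral_z3 (\<epsilon>' * ((1 + v) ^ 2) ^ (3 ^ n))"
    by (intro integral_z3_intros \<epsilon> \<eta> v)+
  ultimately show ?case unfolding w_def by blast
qed

lemma u_power_multiple:
  assumes "3 ^ n * m \<le> k"
  shows "three_power_multiple m (u n ^ k)"
proof -
  obtain \<epsilon> \<epsilon>' where \<epsilon>: "integral_z3 \<epsilon>" "u n ^ (3 ^ n) = 3 * \<epsilon>"
    using u_power_associated_three by blast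
  have "u n ^ k = (u n ^ (3 ^ n)) ^ m * u n ^ (k - 3 ^ n * m)"
    using assms by (simp flip: power_mult power_add)
  also have "\<dots> = 3 ^ m * (\<epsilon> ^ m * u n ^ (k - 3 ^ n * m))"
    by (simp add: \<epsilon>(2) power_mult_distrib mult.assoc)
  finally have "u n ^ k = 3 ^ m * (\<epsilon> ^ m * u n ^ (k - 3 ^ n * m))" .
  moreover have "integral_z3 (\<epsilon> ^ m * u n ^ (k - 3 ^ n * m))"
    by (intro integral_z3_intros \<epsilon>(1) integral_u)
  ultimately show ?thesis unfolding three_power_multiple_def by blast
qed

text \<open>Otherwise a positive power of \<open>u n\<close> would divide the unit \<epsilon>, and
  raising to the power 3^n would make 3 invertible.\<close>

lemma u_power_not_multiple:
  assumes "d < 3 ^ n"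
  shows "\<not> three_power_multiple 1 (u n ^ d)"
proof
  assume "three_power_multiple 1 (u n ^ d)"
  then obtain y where y: "integral_z3 y" "u n ^ d = 3 * y"
    unfolding three_power_multiple_def by auto
  obtain \<epsilon> \<epsilon>' where \<epsilon>: "integral_z3 \<epsilon>" "integral_z3 \<epsilon>'" "\<epsilon> * \<epsilon>' = 1" "u n ^ (3 ^ n) = 3 * \<epsilon>"
    using u_power_associated_three by blast
  define j where "j = 3 ^ n - d"
  have j: "j > 0" using assms by (simp add: j_def)
  have "3 * \<epsilon> = u n ^ d * u n ^ j"
    using assms by (simp add: j_def \<epsilon>(4)[symmetric] flip: power_add)
  hence "\<epsilon> = y * u n ^ j" by (simp add: y(2))
  hence "1 = \<epsilon>' * y * u n ^ j" using \<epsilon>(3) by (simp add: mult_ac)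
  hence "1 = (\<epsilon>' * y * u n ^ j) ^ (3 ^ n)" by simp
  also have "\<dots> = (\<epsilon>' * y) ^ (3 ^ n) * (u n ^ (3 ^ n)) ^ j"
    by (simp add: power_mult_distrib mult.commute flip: power_mult)
  also have "(u n ^ (3 ^ n)) ^ j = 3 * \<epsilon> * (3 * \<epsilon>) ^ (j - 1)"
    unfolding \<epsilon>(4) using j by (metis power_eq_if not_gr_zero)
  finally have "3 * ((\<epsilon>' * y) ^ (3 ^ n) * (\<epsilon> * (3 * \<epsilon>) ^ (j - 1))) = 1"
    by (simp add: mult_ac)
  moreover have "integral_z3 ((\<epsilon>' * y) ^ (3 ^ n) * (\<epsilon> * (3 * \<epsilon>) ^ (j - 1)))"
    by (intro integral_z3_intros \<epsilon> y)
  ultimately show False using three_not_unit by blast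
qed

text \<open>
  Let \<open>d\<close> be the first index at which the coefficients of \<open>f\<close> attain their minimal valuation. As
  \<open>d < 3\<^sup>d\<close>, the term of index \<open>d\<close> alone has the smallest valuation in the value of \<open>f\<close> at \<open>u\<^sub>d\<close>.
\<close>

lemma fps_vanishing_at_u:
  assumes f: "\<And>n. fps_has_value f (u n) 0"
  shows "f = 0"
proof (rule ccontr)
  assume "f \<noteq> 0"
  then obtain k0 where k0: "fps_nth f k0 \<noteq> 0" by (auto simp: fps_eq_iff)
  have ex: "\<exists>e. \<exists>k. \<not> 3 ^ Suc e dvd fps_nth f k"
  proof -
    obtain e b where eb: "fps_nth f k0 = 3 ^ e * b" "b dvd 1" using z3_nonzero_factor[OF k0] .
    have "\<not> 3 ^ Suc e dvd fps_nth f k0"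
    proof
      assume "3 ^ Suc e dvd fps_nth f k0"
      then obtain y where "3 ^ e * b = 3 ^ Suc e * y" unfolding eb(1) by (rule dvdE)
      hence "b = 3 ^ 1 * y" by simp
      hence "3 ^ 1 dvd b" by (metis dvd_triv_left)
      thus False using eb(2) unfolding z3_unit_iff three_power_dvd_iff by simp
    qed
    thus ?thesis by blast
  qed
  \<comment> \<open>The minimal valuation of the coefficients; dividing by 3^e leaves some
    coefficient a unit.\<close>
  define e where "e = (LEAST e. \<exists>k. \<not> 3 ^ Suc e dvd fps_nth f k)"
  have e: "\<exists>k. \<not> 3 ^ Suc e dvd fps_nth f k"
    unfolding e_def by (rule LeastI_ex[OF ex])
  have "3 ^ e dvd fps_nth f k" for k
  proof (cases e)
    case (Suc e')
    thus ?thesis using not_less_Least[of e' "\<lambda>e. \<exists>k. \<not> 3 ^ Suc e dvd fps_nth f k"]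
      unfolding e_def[symmetric] by auto
  qed simp
  then obtain g where g: "\<And>k. fps_nth f k = 3 ^ e * g k" unfolding dvd_def by metis
  have ex': "\<exists>k. \<not> 3 ^ 1 dvd g k"
  proof (rule ccontr)
    assume "\<not> ?thesis"
    hence "3 ^ e * 3 ^ 1 dvd fps_nth f k" for k unfolding g by (intro mult_dvd_mono) auto
    thus False using e by (simp add: mult.commute)
  qed
  define d where "d = (LEAST k. \<not> 3 ^ 1 dvd g k)"
  have "\<not> 3 ^ 1 dvd g d" unfolding d_def by (rule LeastI_ex[OF ex'])
  hence "g d dvd 1" unfolding z3_unit_iff three_power_dvd_iff .
  then obtain g' where g': "1 = g d * g'" by (rule dvdE)
  have g_less: "3 ^ 1 dvd g k" if "k < d" for k
    using not_less_Least[of k "\<lambda>k. \<not> 3 ^ 1 dvd g k"] that unfolding d_def by blast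
  define x where "x = u d"
  have x: "integral_z3 x" by (simp add: x_def integral_u)
  have "\<forall>\<^sub>F N in sequentially. three_power_multiple (Suc e) ((\<Sum>k<N. of_z3 (fps_nth f k) * x ^ k) - 0)"
    using f[of d] unfolding fps_has_value_def tendsto_3adic_iff x_def by blast
  then obtain N where N: "d < N"
    "three_power_multiple (Suc e) (\<Sum>k<N. of_z3 (fps_nth f k) * x ^ k)"
    using eventually_happens'[OF sequentially_bot, OF eventually_conj[OF _ eventually_gt_at_top[of d]]]
    by auto
  obtain y where "integral_z3 y" "(\<Sum>k<N. of_z3 (fps_nth f k) * x ^ k) = 3 ^ Suc e * y"
    using N(2) unfolding three_power_multiple_def by blast
  moreover have "(\<Sum>k<N. of_z3 (fps_nth f k) * x ^ k) = 3 ^ e * (\<Sum>k<N. of_z3 (g k) * x ^ k)"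
    by (simp add: g sum_distrib_left mult.assoc)
  ultimately have total: "three_power_multiple 1 (\<Sum>k<N. of_z3 (g k) * x ^ k)"
    unfolding three_power_multiple_def by auto
  have low: "three_power_multiple 1 (\<Sum>k<d. of_z3 (g k) * x ^ k)"
    using g_less by (intro three_power_multiple_sum three_power_multiple_mult
      three_power_multiple_of_z3 integral_z3_power x) auto
  \<comment> \<open>The terms above index d with x^(d+1) removed. Multiplying by g' turns the
    coefficient at d into 1 and leaves the factor 1 + x W.\<close>
  define V where "V = (\<Sum>k<N - Suc d. of_z3 (g (Suc d + k)) * x ^ k)"
  define W where "W = V * of_z3 g'"
  have W: "integral_z3 W" unfolding W_def V_def by (intro integral_z3_intros x)
  have "(\<Sum>k<Suc d + (N - Suc d). of_z3 (g k) * x ^ k) = (\<Sum>k<Suc d. of_z3 (g k) * x ^ k) +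
      (\<Sum>k<N - Suc d. of_z3 (g (Suc d + k)) * x ^ (Suc d + k))"
    by (rule sum_lessThan_add)
  hence "(\<Sum>k<N. of_z3 (g k) * x ^ k) - (\<Sum>k<d. of_z3 (g k) * x ^ k) =
      x ^ d * (of_z3 (g d) + x * V)"
    using N(1) by (simp add: V_def sum_distrib_left algebra_simps power_add)
  hence "three_power_multiple 1 (x ^ d * (of_z3 (g d) + x * V))"
    using three_power_multiple_diff[OF total low] by simp
  hence "three_power_multiple 1 (x ^ d * (of_z3 (g d) + x * V) * of_z3 g')"
    by (rule three_power_multiple_mult[OF _ integral_of_z3])
  also have "x ^ d * (of_z3 (g d) + x * V) * of_z3 g' = x ^ d * (of_z3 (g d * g') + x * W)"
    by (simp only: W_def of_z3_mult distrib_left distrib_right mult_ac)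
  also have "g d * g' = 1" by (rule g'[symmetric])
  finally have mult: "three_power_multiple 1 (x ^ d * (1 + x * W))" by simp
  \<comment> \<open>Topological nilpotence of x W makes 1 + x W a unit, which is then
    cancelled.\<close>
  have "three_power_multiple 1 (x ^ (3 ^ d))" unfolding x_def by (rule u_power_multiple) simp
  hence "three_power_multiple 1 ((x * W) ^ (3 ^ d))"
    unfolding power_mult_distrib by (intro three_power_multiple_mult integral_z3_power W)
  then obtain t where "integral_z3 t" "(x * W) ^ (3 ^ d) = 3 * t"
    unfolding three_power_multiple_def by auto
  then obtain \<eta> where \<eta>: "integral_z3 \<eta>" "(1 + x * W) * \<eta> = 1"
    by (rule integral_z3_inverse_one_plus[OF integral_z3_mult[OF x W]])
  have "three_power_multiple 1 (x ^ d * (1 + x * W) * \<eta>)"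
    by (rule three_power_multiple_mult[OF mult \<eta>(1)])
  hence "three_power_multiple 1 (x ^ d)" by (simp add: mult.assoc \<eta>(2))
  moreover have "d < 3 ^ d" by (rule less_exp[THEN less_le_trans]) (simp add: power_mono)
  ultimately show False using u_power_not_multiple unfolding x_def by blast
qed

text \<open>\<open>col_coeff a 0\<close> is 2, which the summand -2 in x^a + x^-a - 2
  removes.\<close>

definition col_series :: "z3 \<Rightarrow> z3 fps" where
  "col_series a = Abs_fps (\<lambda>k. if k = 0 then 0 else col_coeff a k)"

text \<open>Replace a by a nearby positive integer m: low coefficients agree modulo 3^M, high powers
  of \<open>u n\<close> are divisible by 3^M, and for m the value is given by
  \<open>sum_col_coeff_nat\<close>.\<close>

lemma col_series_value:
  "fps_has_value (col_series a) (u n)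
     (z n ^ nat (residue a (Suc n)) + inverse (z n) ^ nat (residue a (Suc n)) - 2)"
  unfolding fps_has_value_def tendsto_3adic_iff
proof
  fix M
  define r where "r = nat (residue a (Suc n))"
  \<comment> \<open>From this index on, the powers of \<open>u n\<close> are divisible by
    3^M.\<close>
  define K :: nat where "K = 3 ^ n * M"
  obtain E where E: "\<And>M m k. k < K \<Longrightarrow> m > 0 \<Longrightarrow> 3 ^ (M + E) dvd a - of_nat m \<Longrightarrow>
    3 ^ M dvd col_coeff a k - of_nat (col_coeff_nat m k)"
    using col_coeff_approx by blast
  \<comment> \<open>M + E controls the coefficients; the extra n + 1 makes m and a act alike on
    \<open>z n\<close>.\<close>
  obtain m where m: "m > 0" "3 ^ (M + E + Suc n) dvd a - of_nat m"
    by (rule z3_nat_approx)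
  have dvd: "3 ^ (M + E) dvd a - of_nat m"
    by (rule dvd_trans[OF le_imp_power_dvd m(2)]) simp
  have "z n ^ m = z n ^ r"
  proof -
    have "(3 :: z3) ^ Suc n dvd a - of_nat m"
      by (rule dvd_trans[OF le_imp_power_dvd m(2)]) simp
    hence "residue (a - of_nat m) (Suc n) = 0" by (simp only: three_power_dvd_iff)
    hence "(residue a (Suc n) - int m) mod 3 ^ Suc n = 0"
      by (simp add: minus_z3.rep_eq residue_of_nat mod_simps del: power_Suc)
    hence "int r mod 3 ^ Suc n = int m mod 3 ^ Suc n"
      using residue_range(1)[of a "Suc n"]
      by (simp add: r_def mod_eq_dvd_iff dvd_eq_mod_eq_0 del: power_Suc)
    hence "int (r mod 3 ^ Suc n) = int (m mod 3 ^ Suc n)"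
      by (simp add: of_nat_mod del: power_Suc)
    thus ?thesis unfolding z_power_eq_iff by (simp only: of_nat_eq_iff)
  qed
  hence zm: "z n ^ m + inverse (z n) ^ m = z n ^ r + inverse (z n) ^ r"
    by (simp add: power_inverse)
  have z1: "z n + 1 \<noteq> 0"
  proof
    assume "z n + 1 = 0"
    hence "z n = - 1" by (simp add: eq_neg_iff_add_eq_0)
    hence "(- 1) ^ (3 ^ Suc n) = (1 :: q3bar)" using z_power_Suc by metis
    moreover have "odd (3 ^ Suc n :: nat)" by simp
    hence "(- 1) ^ (3 ^ Suc n) = - (1 :: q3bar)" by (metis power_minus_odd power_one)
    ultimately show False by simp
  qed
  have "three_power_multiple M ((\<Sum>k<N. of_z3 (fps_nth (col_series a) k) * u n ^ k) -
      (z n ^ r + inverse (z n) ^ r - 2))" if N: "Suc K \<le> N" for N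
  proof -
    \<comment> \<open>N' also exceeds m, so that the polynomial for m is summed completely; a' pads
      the truncated series with zeros.\<close>
    define N' where "N' = max N (Suc m)"
    have NN': "N \<le> N'" "m < N'" by (auto simp: N'_def)
    define a' where "a' k = (if k < N then col_coeff a k else 0)" for k
    have "(\<Sum>k<N. of_z3 (fps_nth (col_series a) k) * u n ^ k) + 2 = (\<Sum>k<N. of_z3 (col_coeff a k) * u n ^ k)"
    proof -
      obtain l where l: "N = Suc l" using N by (cases N) auto
      show ?thesis unfolding l sum.lessThan_Suc_shift
        by (simp add: col_series_def col_coeff_0)
    qed
    also have "\<dots> = (\<Sum>k<N'. of_z3 (a' k) * u n ^ k)"
      using NN' by (intro sum.mono_neutral_cong_left) (auto simp: a'_def)
    finally have lhs: "(\<Sum>k<N. of_z3 (fps_nth (col_series a) k) * u n ^ k) =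
      (\<Sum>k<N'. of_z3 (a' k) * u n ^ k) - 2" by (simp add: eq_diff_eq)
    have "z n ^ r + inverse (z n) ^ r = (\<Sum>k<N'. of_nat (col_coeff_nat m k) * u n ^ k)"
      using sum_col_coeff_nat[OF z_nonzero z1 u_eq m(1) NN'(2)] zm by simp
    hence eq: "(\<Sum>k<N. of_z3 (fps_nth (col_series a) k) * u n ^ k) - (z n ^ r + inverse (z n) ^ r - 2)
      = (\<Sum>k<N'. of_z3 (a' k - of_nat (col_coeff_nat m k)) * u n ^ k)"
      unfolding lhs by (simp add: left_diff_distrib sum_subtractf)
    show ?thesis unfolding eq
    proof (rule three_power_multiple_sum)
      fix k
      show "three_power_multiple M (of_z3 (a' k - of_nat (col_coeff_nat m k)) * u n ^ k)"
      proof (cases "k < K")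
        case True
        hence "3 ^ M dvd a' k - of_nat (col_coeff_nat m k)"
          using E[OF True m(1) dvd] N by (simp add: a'_def)
        thus ?thesis
          by (intro three_power_multiple_mult three_power_multiple_of_z3 integral_z3_power integral_u)
      next
        case False
        hence "three_power_multiple M (u n ^ k)" unfolding K_def by (intro u_power_multiple) simp
        thus ?thesis using three_power_multiple_mult[OF _ integral_of_z3] by (metis mult.commute)
      qed
    qed
  qed
  thus "\<forall>\<^sub>F N in sequentially. three_power_multiple M
      ((\<Sum>k<N. of_z3 (fps_nth (col_series a) k) * u n ^ k) -
       (z n ^ nat (residue a (Suc n)) + inverse (z n) ^ nat (residue a (Suc n)) - 2))"
    unfolding r_def[symmetric] by (rule eventually_sequentiallyI)
qed

text \<open>Two such series differ by one that vanishes along the tower.\<close>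

lemma Col_eqI:
  assumes "\<And>n. fps_has_value f (u n) (g (u n))"
  shows "Col u g = f"
  unfolding Col_def
proof (rule the_equality)
  fix h assume h: "\<forall>n. fps_has_value h (u n) (g (u n))"
  have "h - f = 0"
    using fps_has_value_diff[OF h[rule_format] assms] by (intro fps_vanishing_at_u) simp
  thus "h = f" by simp
qed (use assms in blast)

end

section \<open>Comparison of \<open>eta\<close> with the cyclotomic character\<close>

context cyclotomic_tower
begin

lemma eta_eq_chi_cyc_square:
  assumes g: "g \<in> Gal UNIV Q3"
  shows "eta u (restrict g (K_inf u)) = chi_cyc g ^ 2"
proof -
  have UNIV_field: "intermediate_field (UNIV :: q3bar set)" by unfold_locales auto
  have "Col u (restrict g (K_inf u)) = col_series (chi_cyc g)"
  proof (rule Col_eqI)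
    fix n
    have g_add: "g (x + y) = g x + g y" for x y using GalD(3)[OF g] by simp
    have "-2 \<in> Q3" using range_eqI[of "-2" to_ac "-2"] by simp
    hence g2: "g (- 2) = - 2" by (rule GalD(5)[OF g])
    have gz: "g (z n) = z n ^ nat (residue (chi_cyc g) (Suc n))"
      using cyclotomic_exponent_Gal[OF g subset_UNIV] z_power_Suc
      unfolding cyclotomic_exponent_def by blast
    have "restrict g (K_inf u) (u n) = g (u n)" by (simp add: u_in_K_inf)
    also have "\<dots> = g (z n + inverse (z n) + (- 2))" by (simp add: u_eq)
    also have "\<dots> = z n ^ nat (residue (chi_cyc g) (Suc n)) +
        inverse (z n) ^ nat (residue (chi_cyc g) (Suc n)) - 2"
      unfolding g_add g2 Gal_inverse[OF g UNIV_field UNIV_I] gz by (simp add: power_inverse)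
    finally have eq: "restrict g (K_inf u) (u n) = z n ^ nat (residue (chi_cyc g) (Suc n)) +
        inverse (z n) ^ nat (residue (chi_cyc g) (Suc n)) - 2" .
    show "fps_has_value (col_series (chi_cyc g)) (u n) (restrict g (K_inf u) (u n))"
      unfolding eq by (rule col_series_value)
  qed
  thus ?thesis by (simp add: eta_def col_series_def col_coeff_1[simplified])
qed

end

text \<open>Under \<open>chi_cyc\<close> the automorphisms with value 1 or -1 form the subgroup
  {1,-1}. Restricting g to \<open>K_inf u\<close> expresses that \<open>eta\<close> is inflated from
  the Galois group of the tower.\<close>

theorem theorem6p5:
  fixes u :: "nat \<Rightarrow> q3bar"
  assumes "u 0 = -3"
    and "\<And>n. u (Suc n) ^ 3 + 6 * u (Suc n) ^ 2 + 9 * u (Suc n) = u n"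
  shows "K_inf u = fixed_field (Q3_adjoin mu_3inf)
           {\<sigma> \<in> Gal (Q3_adjoin mu_3inf) Q3. chi_cyc \<sigma> \<in> {1, -1}}
       \<and> (\<forall>g \<in> Gal UNIV Q3. eta u (restrict g (K_inf u)) = chi_cyc g ^ 2)"
proof -
  obtain z where "cyclotomic_tower u z"
    using exists_cyclotomic_tower[of u] assms by blast
  then interpret cyclotomic_tower u z .
  show ?thesis using K_inf_eq_fixed_field eta_eq_chi_cyc_square by blast
qed

end
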